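(* Fix an integer $\Lambda\ge2$ and let $G=(V,E)$ be a loopless series-parallel graph of maxmaxflow at most $\Lambda$. Let $\rho^\star_\Lambda$ be the unique solution in $(0,1)$ of $(1+\rho)^\Lambda=2(1+\rho^2)^{\Lambda-1}$ when $\Lambda\ge3$, and $\rho^\star_2=1$. Let $q\in\mathbb C$ satisfy $|q-1|\ge1/\rho^\star_\Lambda$ (strict inequality $>$ when $\Lambda=2$), put $\rho=1/|q-1|$ and $X=\big(2/(1+\rho)\big)^{1/(\Lambda-1)}$, and let edge weights $\mathbf v=(v_e)_{e\in E}$ satisfy, for each $e$, either $v_e=-1$ or $q+v_e\neq0$ and $\left|\dfrac{v_e}{q+v_e}\right|\le\rho\,\dfrac{X-1}{1-\rho X}$ (with strict inequality when $\Lambda=2$). Then $Z_G(q,\mathbf v)\neq0$. Furthermore $\rho^\star_\Lambda>(\log2)/(\Lambda-\tfrac32\log2)$ for every integer $\Lambda\ge2$; in particular all roots of the chromatic polynomial $P_G(q)$ lie in the disc $|q-1|<(\Lambda-\tfrac32\log2)/\log2$.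
   Context: Multivariate Tutte polynomial of $G=(V,E)$: $Z_G(q,\mathbf v)=\sum_{A\subseteq E}q^{k(A)}\prod_{e\in A}v_e$, $k(A)$ = number of connected components of $(V,A)$; chromatic polynomial $P_G(q)=Z_G(q,\mathbf v)$ with all $v_e=-1$. $\lambda_G(x,y)$ = maximum number of pairwise edge-disjoint $x$–$y$ paths; maxmaxflow $\Lambda(G)=\max_{x\ne y}\lambda_G(x,y)$ (0 if fewer than two vertices). A loopless graph is series-parallel if it can be obtained from a forest by a finite (possibly empty) sequence of operations, each replacing an edge by two edges in series (subdivision) or by two parallel edges. *)

theory Defs
  imports Complex_Main
begin

text \<open>A finite multigraph is given by a vertex set V, an edge set E and an
  endpoint map ends :: 'e => 'v set (ends e = {a,b}; a loop has ends e = {a}).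
  Only the values of ends on E are relevant.\<close>

definition wf_graph :: "'v set \<Rightarrow> 'e set \<Rightarrow> ('e \<Rightarrow> 'v set) \<Rightarrow> bool" where
  "wf_graph V E ends \<longleftrightarrow> finite V \<and> finite E \<and>
     (\<forall>e\<in>E. ends e \<subseteq> V \<and> (card (ends e) = 1 \<or> card (ends e) = 2))"

definition loopless :: "'e set \<Rightarrow> ('e \<Rightarrow> 'v set) \<Rightarrow> bool" where
  "loopless E ends \<longleftrightarrow> (\<forall>e\<in>E. card (ends e) = 2)"

text \<open>Connectivity of the spanning subgraph (V,A) and its number of components k(A).\<close>

definition adj :: "('e \<Rightarrow> 'v set) \<Rightarrow> 'e set \<Rightarrow> ('v \<times> 'v) set" where
  "adj ends A = {(u, w). \<exists>e\<in>A. ends e = {u, w}}"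

definition num_components :: "'v set \<Rightarrow> ('e \<Rightarrow> 'v set) \<Rightarrow> 'e set \<Rightarrow> nat" where
  "num_components V ends A = card (V // Restr ((adj ends A)\<^sup>*) V)"

text \<open>Multivariate Tutte polynomial and chromatic polynomial.\<close>

definition tutteZ :: "'v set \<Rightarrow> 'e set \<Rightarrow> ('e \<Rightarrow> 'v set) \<Rightarrow> complex \<Rightarrow> ('e \<Rightarrow> complex) \<Rightarrow> complex" where
  "tutteZ V E ends q v = (\<Sum>A\<in>Pow E. q ^ num_components V ends A * (\<Prod>e\<in>A. v e))"

definition chrom_poly :: "'v set \<Rightarrow> 'e set \<Rightarrow> ('e \<Rightarrow> 'v set) \<Rightarrow> complex \<Rightarrow> complex" where
  "chrom_poly V E ends q = tutteZ V E ends q (\<lambda>_. -1)"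

text \<open>Paths (given by their edge list) from x to y, with distinct vertices.\<close>

definition is_path :: "'e set \<Rightarrow> ('e \<Rightarrow> 'v set) \<Rightarrow> 'v \<Rightarrow> 'v \<Rightarrow> 'e list \<Rightarrow> bool" where
  "is_path E ends x y es \<longleftrightarrow> (\<exists>vs. length vs = Suc (length es) \<and> vs ! 0 = x \<and> last vs = y \<and>
      distinct vs \<and> (\<forall>i<length es. es ! i \<in> E \<and> ends (es ! i) = {vs ! i, vs ! Suc i}))"

text \<open>lambda_G(x,y): maximum number of pairwise edge-disjoint x-y paths.\<close>

definition local_edge_conn :: "'e set \<Rightarrow> ('e \<Rightarrow> 'v set) \<Rightarrow> 'v \<Rightarrow> 'v \<Rightarrow> nat" where
  "local_edge_conn E ends x y = Max {card P | P. P \<subseteq> {p. is_path E ends x y p} \<and>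
      (\<forall>p\<in>P. \<forall>p'\<in>P. p \<noteq> p' \<longrightarrow> set p \<inter> set p' = {})}"

definition maxmaxflow :: "'v set \<Rightarrow> 'e set \<Rightarrow> ('e \<Rightarrow> 'v set) \<Rightarrow> nat" where
  "maxmaxflow V E ends = (if card V < 2 then 0 else
      Max {local_edge_conn E ends x y | x y. x \<in> V \<and> y \<in> V \<and> x \<noteq> y})"

text \<open>Cycles (closed trails with distinct inner vertices) and forests.\<close>

definition is_cycle :: "'e set \<Rightarrow> ('e \<Rightarrow> 'v set) \<Rightarrow> 'e list \<Rightarrow> bool" where
  "is_cycle E ends es \<longleftrightarrow> es \<noteq> [] \<and> distinct es \<and>
     (\<exists>vs. length vs = Suc (length es) \<and> vs ! 0 = last vs \<and> distinct (tl vs) \<and>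
        (\<forall>i<length es. es ! i \<in> E \<and> ends (es ! i) = {vs ! i, vs ! Suc i}))"

definition is_forest :: "'v set \<Rightarrow> 'e set \<Rightarrow> ('e \<Rightarrow> 'v set) \<Rightarrow> bool" where
  "is_forest V E ends \<longleftrightarrow> wf_graph V E ends \<and> loopless E ends \<and> \<not> (\<exists>es. is_cycle E ends es)"

text \<open>Series-parallel graphs: obtained from a forest by subdividing an edge
  (series) or doubling an edge (parallel).\<close>

inductive sp_ind :: "'v set \<Rightarrow> 'e set \<Rightarrow> ('e \<Rightarrow> 'v set) \<Rightarrow> bool" where
  forest: "is_forest V E ends \<Longrightarrow> sp_ind V E ends"
| series: "\<lbrakk>sp_ind V E ends; e \<in> E; ends e = {a, b}; w \<notin> V; e1 \<noteq> e2;
            e1 \<notin> E - {e}; e2 \<notin> E - {e}\<rbrakk>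
           \<Longrightarrow> sp_ind (insert w V) (insert e1 (insert e2 (E - {e})))
                 (ends(e1 := {a, w}, e2 := {w, b}))"
| parallel: "\<lbrakk>sp_ind V E ends; e \<in> E; e1 \<noteq> e2; e1 \<notin> E - {e}; e2 \<notin> E - {e}\<rbrakk>
           \<Longrightarrow> sp_ind V (insert e1 (insert e2 (E - {e})))
                 (ends(e1 := ends e, e2 := ends e))"

definition series_parallel :: "'v set \<Rightarrow> 'e set \<Rightarrow> ('e \<Rightarrow> 'v set) \<Rightarrow> bool" where
  "series_parallel V E ends \<longleftrightarrow> (\<exists>ends'. (\<forall>e\<in>E. ends' e = ends e) \<and> sp_ind V E ends')"

text \<open>rho*_Lambda.\<close>

definition rho_star :: "nat \<Rightarrow> real" where
  "rho_star L = (if L = 2 then 1 else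
     (THE r. 0 < r \<and> r < 1 \<and> (1 + r) ^ L = 2 * (1 + r\<^sup>2) ^ (L - 1)))"

end

theory Submission
  imports Defs "HOL-Analysis.Harmonic_Numbers"
begin

text \<open>Undo the series and parallel operations one at a time, replacing a pair of edges by one
  effective edge with transmissivity \<open>t = v / (q + v)\<close>. Effective edges carry a capacity, added in
  parallel and minimized in series, so that the minimum cuts stay bounded by \<open>\<Lambda>\<close> (Menger turns
  the bound on edge-disjoint paths into this one). The invariant is that an edge of capacity \<open>k\<close>
  that is not a bridge has either \<open>v = -1\<close> or \<open>\<bar>t\<bar> \<le> r\<^sub>k = \<rho> (X^k - 1) / (1 - \<rho> X^k)\<close>. Parallel
  connection maps the discs of radii \<open>r\<^sub>k, r\<^sub>l\<close> into the disc of radius \<open>r\<^sub>k\<^sub>+\<^sub>l\<close>; since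
  \<open>r\<^sub>\<Lambda>\<^sub>-\<^sub>1 = \<rho>\<close> is also the transmissivity modulus at \<open>v = -1\<close>, series connection always lands in
  the disc of radius \<open>\<rho>\<^sup>2\<close>, and \<open>\<rho>\<^sup>2 \<le> r\<^sub>1\<close> is exactly the inequality defining \<open>\<rho>\<^sup>\<star>\<close>. Bridges only
  contribute a factor \<open>1 / q\<close>, whatever their weight.\<close>

section \<open>Cuts, paths and Menger's theorem\<close>

text \<open>The obstacle is an edge that has absorbed the full capacity \<open>\<Lambda>\<close>:
  the radii are controlled only up to \<open>\<Lambda> - 1\<close>, where they reach
  \<open>\<rho>\<close>, so no disc is available for it. Such an edge fills a whole cut of capacity
  \<open>\<Lambda>\<close> by itself, hence is a bridge. This is why the invariant exempts bridges,
  and it also settles the base case: in a forest every edge is a bridge, and no weight has to be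
  examined. The value \<open>v = -1\<close> is carried as a separate alternative because for
  \<open>\<Lambda> \<ge> 3\<close> its transmissivity, of modulus \<open>\<rho>\<close>, lies
  outside the disc of radius \<open>r_1\<close>. It does no harm: parallel connection with any edge
  reproduces it, and one series connection brings the modulus down to \<open>\<rho>^2\<close>. Cuts
  rather than path families are propagated, since a vertex set \<open>S\<close> that witnesses a
  capacity bound keeps witnessing it, unchanged, after two edges are merged into one.\<close>

definition cut :: "'e set \<Rightarrow> ('e \<Rightarrow> 'v set) \<Rightarrow> 'v set \<Rightarrow> 'e set" where
  "cut E ends S = {e \<in> E. ends e \<inter> S \<noteq> {} \<and> \<not> ends e \<subseteq> S}"

text \<open>Stated through cuts rather than components, so that the set \<open>S\<close> certifying
  a bridge can be followed through the reductions exactly like one that bounds a capacity.\<close>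

definition bridge :: "'e set \<Rightarrow> ('e \<Rightarrow> 'v set) \<Rightarrow> 'e \<Rightarrow> bool" where
  "bridge E ends e \<longleftrightarrow> (\<exists>S. cut E ends S = {e})"

text \<open>The step relation is a parameter so that one search serves three graphs: the residual
  graph of a flow, the arcs that carry flow, and a forest with one edge removed. The vertex list
  supplies the witness demanded by \<open>is_path\<close> and \<open>is_cycle\<close>.\<close>

inductive dipath :: "('e \<Rightarrow> 'v \<Rightarrow> 'v \<Rightarrow> bool) \<Rightarrow> 'v \<Rightarrow> 'v \<Rightarrow> 'e list \<Rightarrow> 'v list \<Rightarrow> bool"
  for step where
  Nil: "dipath step x x [] [x]"
| Cons: "\<lbrakk>step e x z; dipath step z y es vs; x \<notin> set vs\<rbrakk> \<Longrightarrow> dipath step x y (e # es) (x # vs)"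

lemma dipath_suffix:
  assumes "dipath step z y es vs" "x \<in> set vs"
  shows "\<exists>es' vs'. dipath step x y es' vs'"
  using assms by induction (auto intro: dipath.intros)

text \<open>\<open>S\<close> collects the vertices from which \<open>y\<close> cannot be reached.
  Since paths grow at the front, closure of \<open>S\<close> is a single \<open>Cons\<close>, or a
  suffix if the new vertex already lies on the path.\<close>

lemma dipath_or_closed:
  assumes "\<nexists>es vs. dipath step x y es vs"
  obtains S where "x \<in> S" "y \<notin> S" "\<And>e u w. step e u w \<Longrightarrow> u \<in> S \<Longrightarrow> w \<in> S"
proof
  let ?S = "{u. \<nexists>es vs. dipath step u y es vs}"
  show "x \<in> ?S" using assms by simp
  show "y \<notin> ?S" by (auto intro: dipath.Nil)
  show "w \<in> ?S" if "step e u w" "u \<in> ?S" for e u w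
  proof
    show "\<nexists>es vs. dipath step w y es vs"
    proof
      assume "\<exists>es vs. dipath step w y es vs"
      then obtain es vs where p: "dipath step w y es vs" by blast
      show False
        using that p dipath_suffix[OF p, of u] dipath.Cons[of step e u w, OF that(1) p] by blast
    qed
  qed
qed

lemma dipath_imp_vertex_list:
  assumes "dipath step x y es vs" "\<And>e u w. step e u w \<Longrightarrow> e \<in> E \<and> ends e = {u, w}"
  shows "length vs = Suc (length es) \<and> vs ! 0 = x \<and> last vs = y \<and> distinct vs \<and>
    (\<forall>i<length es. es ! i \<in> E \<and> ends (es ! i) = {vs ! i, vs ! Suc i})"
  using assms(1)
proof induction
  case (Nil x)
  then show ?case by simp
next
  case (Cons e x z y es vs)
  then have "(e # es) ! i \<in> E \<and> ends ((e # es) ! i) = {(x # vs) ! i, (x # vs) ! Suc i}"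
    if "i < length (e # es)" for i
    using that assms(2) by (cases i) auto
  with Cons show ?case by auto
qed

lemma dipath_imp_is_path:
  assumes "dipath step x y es vs" "\<And>e u w. step e u w \<Longrightarrow> e \<in> E \<and> ends e = {u, w}"
  shows "is_path E ends x y es"
  unfolding is_path_def using dipath_imp_vertex_list[of step x y es vs E ends, OF assms] by blast

lemma dipath_ends_subset:
  assumes "dipath step x y es vs" "\<And>e u w. step e u w \<Longrightarrow> ends e = {u, w}" 
  shows "x \<in> set vs \<and> (\<forall>e\<in>set es. ends e \<subseteq> set vs)"
  using assms(1) by induction (auto dest!: assms(2))

lemma dipath_distinct:
  assumes "dipath step x y es vs" "\<And>e u w. step e u w \<Longrightarrow> ends e = {u, w}"
  shows "distinct es"
  using assms(1)
proof induction
  case (Cons e x z y es vs)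
  then show ?case
    using dipath_ends_subset[of step z y es vs ends, OF Cons(2) assms(2)] assms(2)[OF Cons(1)] by auto
qed simp

text \<open>An integral flow is an integer function on the edges, measured against a reference
  orientation.\<close>

definition divergence :: "'e set \<Rightarrow> ('e \<Rightarrow> 'v) \<Rightarrow> ('e \<Rightarrow> 'v) \<Rightarrow> ('e \<Rightarrow> int) \<Rightarrow> 'v \<Rightarrow> int" where
  "divergence E src dst f u = (\<Sum>e\<in>E. f e * (of_bool (src e = u) - of_bool (dst e = u)))"

lemma sum_divergence:
  assumes "finite S"
  shows "(\<Sum>u\<in>S. divergence E src dst f u) =
    (\<Sum>e\<in>E. f e * (of_bool (src e \<in> S) - of_bool (dst e \<in> S)))"
proof -
  have *: "(\<Sum>u\<in>S. of_bool (z = u)) = (of_bool (z \<in> S) :: int)" for z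
    using assms by (simp add: of_bool_def sum.delta')
  show ?thesis
    unfolding divergence_def
    by (subst sum.swap) (simp add: sum_distrib_left[symmetric] sum_subtractf *)
qed

definition flow_of_value ::
  "'e set \<Rightarrow> ('e \<Rightarrow> 'v) \<Rightarrow> ('e \<Rightarrow> 'v) \<Rightarrow> 'v \<Rightarrow> 'v \<Rightarrow> nat \<Rightarrow> ('e \<Rightarrow> int) \<Rightarrow> bool" where
  "flow_of_value E src dst x y k f \<longleftrightarrow> (\<forall>e\<in>E. \<bar>f e\<bar> \<le> 1) \<and>
     (\<forall>u. divergence E src dst f u = int k * (of_bool (u = x) - of_bool (u = y)))"

lemma flow_value_across:
  assumes "flow_of_value E src dst x y k f" "finite S" "x \<in> S" "y \<notin> S"
  shows "(\<Sum>e\<in>E. f e * (of_bool (src e \<in> S) - of_bool (dst e \<in> S))) = int k"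
proof -
  have "(\<Sum>u\<in>S. divergence E src dst f u) = (\<Sum>u\<in>S. int k * of_bool (u = x))"
    using assms by (intro sum.cong) (auto simp: flow_of_value_def)
  also have "\<dots> = int k"
    using assms(2,3) by (simp add: of_bool_def sum_distrib_left[symmetric] sum.delta)
  finally show ?thesis by (simp add: sum_divergence[OF assms(2)])
qed

text \<open>\<open>A\<close> and \<open>B\<close> stand for sign conditions on an ambient flow that
  permit forward and backward traversal. They are returned together with the values 1 and -1, so
  that a caller can check that adding or subtracting \<open>g\<close> keeps the flow within its
  bounds.\<close>

lemma dipath_unit_flow:
  assumes "dipath step x y es vs" "finite E"
    and ends: "\<And>e. e \<in> E \<Longrightarrow> ends e = {src e, dst e} \<and> src e \<noteq> dst e"
    and step: "\<And>e u w. step e u w \<Longrightarrow>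
      e \<in> E \<and> (u = src e \<and> w = dst e \<and> A e \<or> u = dst e \<and> w = src e \<and> B e)"
  shows "\<exists>g. (\<forall>e. e \<notin> set es \<longrightarrow> g e = 0) \<and>
    (\<forall>e\<in>set es. e \<in> E \<and> (g e = 1 \<and> A e \<or> g e = -1 \<and> B e)) \<and>
    (\<forall>u. divergence E src dst g u = of_bool (u = x) - of_bool (u = y))"
  using assms(1)
proof induction
  case (Nil x)
  then show ?case by (auto simp: divergence_def intro!: exI[of _ "\<lambda>_. 0"])
next
  case (Cons e x z y es vs)
  from Cons.IH obtain g where g: "\<forall>e. e \<notin> set es \<longrightarrow> g e = 0"
    "\<forall>e\<in>set es. e \<in> E \<and> (g e = 1 \<and> A e \<or> g e = -1 \<and> B e)"
    "\<forall>u. divergence E src dst g u = of_bool (u = z) - of_bool (u = y)" by blast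
  have st: "step e u w \<Longrightarrow> ends e = {u, w}" for e u w using step[of e u w] ends[of e] by auto
  have "\<forall>e\<in>set es. ends e \<subseteq> set vs"
    using dipath_ends_subset[of step z y es vs ends, OF Cons.hyps(2) st] by blast
  then have nin: "e \<notin> set es" using Cons.hyps(3) st[OF Cons.hyps(1)] by auto
  have eE: "e \<in> E" using step Cons.hyps(1) by blast
  define s :: int where "s = (if x = src e \<and> z = dst e \<and> A e then 1 else -1)"
  have s: "s = 1 \<and> x = src e \<and> z = dst e \<and> A e \<or> s = -1 \<and> x = dst e \<and> z = src e \<and> B e"
    using step[OF Cons.hyps(1)] by (auto simp: s_def)
  have "divergence E src dst (g(e := s)) u = divergence E src dst g u +
      s * (of_bool (src e = u) - of_bool (dst e = u))" for u
    unfolding divergence_def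
    using g(1) nin eE assms(2) by (subst (1 2) sum.remove[of _ e]) (auto intro!: sum.cong)
  moreover have "s * (of_bool (src e = u) - of_bool (dst e = u)) = of_bool (u = x) - of_bool (u = z)" for u
    using s by auto
  ultimately have "divergence E src dst (g(e := s)) u = of_bool (u = x) - of_bool (u = y)" for u
    using g(3) by simp
  moreover have "\<forall>e'. e' \<notin> set (e # es) \<longrightarrow> (g(e := s)) e' = 0" using g(1) by auto
  moreover have "\<forall>e'\<in>set (e # es). e' \<in> E \<and> ((g(e := s)) e' = 1 \<and> A e' \<or> (g(e := s)) e' = -1 \<and> B e')"
    using g(2) s eE nin by auto
  ultimately show ?case by blast
qed

lemma divergence_add:
  "divergence E src dst (\<lambda>e. f e + c * g e) u = divergence E src dst f u + c * divergence E src dst g u"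
  by (simp add: divergence_def sum.distrib sum_distrib_left algebra_simps sum_subtractf)

text \<open>If no path follows the flow, the resulting closed set has no net flow out of it,
  although every set containing \<open>x\<close> but not \<open>y\<close> must emit
  \<open>Suc k\<close>. Subtracting a path makes the flow vanish on its edges, and later paths use
  only edges with nonzero flow; this is where disjointness comes from.\<close>

lemma flow_decomposition:
  assumes "finite V" "finite E"
    and ends: "\<And>e. e \<in> E \<Longrightarrow> ends e = {src e, dst e} \<and> src e \<noteq> dst e"
    and V: "\<And>e. e \<in> E \<Longrightarrow> ends e \<subseteq> V" and "x \<in> V" "x \<noteq> y"
    and "flow_of_value E src dst x y k f"
  shows "\<exists>P. finite P \<and> card P = k \<and>
    (\<forall>p\<in>P. is_path E ends x y p \<and> p \<noteq> [] \<and> (\<forall>e\<in>set p. f e \<noteq> 0)) \<and>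
    (\<forall>p\<in>P. \<forall>p'\<in>P. p \<noteq> p' \<longrightarrow> set p \<inter> set p' = {})"
  using assms(7)
proof (induction k arbitrary: f)
  case 0
  then show ?case by (intro exI[of _ "{}"]) auto
next
  case (Suc k)
  define step where "step e u w \<longleftrightarrow> e \<in> E \<and> (u = src e \<and> w = dst e \<and> f e > 0 \<or> u = dst e \<and> w = src e \<and> f e < 0)"
    for e u w
  have st: "e \<in> E \<and> ends e = {u, w}" if "step e u w" for e u w
    using that ends[of e] by (auto simp: step_def)
  have "\<exists>es vs. dipath step x y es vs"
  proof (rule ccontr)
    assume "\<nexists>es vs. dipath step x y es vs"
    then obtain S where S: "x \<in> S" "y \<notin> S" "\<And>e u w. step e u w \<Longrightarrow> u \<in> S \<Longrightarrow> w \<in> S"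
      using dipath_or_closed[of step x y] by metis
    have "f e * (of_bool (src e \<in> S \<inter> V) - of_bool (dst e \<in> S \<inter> V)) \<le> 0" if "e \<in> E" for e
    proof -
      have "src e \<in> V" "dst e \<in> V" using ends[OF that] V[OF that] by auto
      moreover have "src e \<in> S \<Longrightarrow> dst e \<notin> S \<Longrightarrow> \<not> f e > 0" "dst e \<in> S \<Longrightarrow> src e \<notin> S \<Longrightarrow> \<not> f e < 0"
        using S(3)[of e "src e" "dst e"] S(3)[of e "dst e" "src e"] that by (auto simp: step_def)
      ultimately show ?thesis by (auto simp: of_bool_def)
    qed
    then have "(\<Sum>e\<in>E. f e * (of_bool (src e \<in> S \<inter> V) - of_bool (dst e \<in> S \<inter> V))) \<le> 0"
      by (rule sum_nonpos)
    with flow_value_across[OF Suc.prems, of "S \<inter> V"] S assms show False by simp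
  qed
  then obtain p vs where p: "dipath step x y p vs" by blast
  then obtain g where g: "\<forall>e. e \<notin> set p \<longrightarrow> g e = 0"
    "\<forall>e\<in>set p. e \<in> E \<and> (g e = 1 \<and> f e > 0 \<or> g e = -1 \<and> f e < 0)"
    "\<forall>u. divergence E src dst g u = of_bool (u = x) - of_bool (u = y)"
    using dipath_unit_flow[OF p assms(2), of ends src dst, OF ends, of "\<lambda>e. f e > 0" "\<lambda>e. f e < 0"] step_def by blast
  define f' where "f' e = f e + (-1) * g e" for e
  have f': "f' e = 0" if "e \<in> set p" for e
  proof -
    have "\<bar>f e\<bar> \<le> 1" using Suc.prems g(2) that by (auto simp: flow_of_value_def)
    then show ?thesis using g(2) that by (force simp: f'_def)
  qed
  have f'2: "f' e = f e" if "e \<notin> set p" for e using g(1) that by (simp add: f'_def)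
  have "flow_of_value E src dst x y k f'"
    unfolding flow_of_value_def
  proof (intro conjI ballI allI)
    show "\<bar>f' e\<bar> \<le> 1" if "e \<in> E" for e
      using f'[of e] f'2[of e] Suc.prems that by (cases "e \<in> set p") (auto simp: flow_of_value_def)
    show "divergence E src dst f' u = int k * (of_bool (u = x) - of_bool (u = y))" for u
    proof -
      have *: "divergence E src dst f u = int (Suc k) * (of_bool (u = x) - of_bool (u = y))"
        using Suc.prems by (simp add: flow_of_value_def)
      show ?thesis
        unfolding f'_def divergence_add * g(3)[rule_format] by (simp add: algebra_simps)
    qed
  qed
  from Suc.IH[OF this] obtain P where P: "finite P" "card P = k"
    "\<forall>p\<in>P. is_path E ends x y p \<and> p \<noteq> [] \<and> (\<forall>e\<in>set p. f' e \<noteq> 0)"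
    "\<forall>p\<in>P. \<forall>p'\<in>P. p \<noteq> p' \<longrightarrow> set p \<inter> set p' = {}" by (elim exE conjE) (rule that)
  have p1: "p \<noteq> []" using p assms(6) by (auto elim: dipath.cases)
  have disj: "set p \<inter> set p' = {}" if "p' \<in> P" for p' using P(3) f' that by blast
  then have "p \<notin> P" using p1 by (metis Int_absorb set_empty)
  moreover have "is_path E ends x y p" using dipath_imp_is_path[of step x y p vs E ends, OF p st] .
  moreover have "\<forall>e\<in>set p. f e \<noteq> 0" using g(2) by auto
  moreover have "\<forall>p'\<in>P. \<forall>e\<in>set p'. f e \<noteq> 0" using P(3) disj f'2 by (metis disjoint_iff)
  ultimately show ?case
    using P p1 disj by (intro exI[of _ "insert p P"]) (auto simp: Int_commute)
qed

text \<open>Augmenting paths: values of flows are at most \<open>card E\<close> (test against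
  \<open>{x}\<close>), so a maximal value exists. A path in the residual graph would raise it, hence
  there is none, and the set closed under residual steps is a cut whose size equals the
  value.\<close>

theorem menger_edge:
  assumes "finite V" "finite E"
    and ends: "\<And>e. e \<in> E \<Longrightarrow> ends e \<subseteq> V \<and> card (ends e) = 2" and "x \<in> V" "x \<noteq> y"
  obtains S P where "x \<in> S" "y \<notin> S" "finite P" "card P = card (cut E ends S)"
    "\<forall>p\<in>P. is_path E ends x y p" "\<forall>p\<in>P. \<forall>p'\<in>P. p \<noteq> p' \<longrightarrow> set p \<inter> set p' = {}"
proof -
  have "\<exists>a b. ends e = {a, b} \<and> a \<noteq> b" if "e \<in> E" for e
    using ends[OF that] by (meson card_2_iff)
  then obtain src dst where sd: "\<And>e. e \<in> E \<Longrightarrow> ends e = {src e, dst e} \<and> src e \<noteq> dst e"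
    by metis
  let ?Q = "\<lambda>k. \<exists>f. flow_of_value E src dst x y k f"
  have "?Q 0" by (intro exI[of _ "\<lambda>_. 0"]) (simp add: flow_of_value_def divergence_def)
  moreover have "k \<le> card E" if "?Q k" for k
  proof -
    from that obtain f where f: "flow_of_value E src dst x y k f" by blast
    have "int k = (\<Sum>e\<in>E. f e * (of_bool (src e \<in> {x}) - of_bool (dst e \<in> {x})))"
      using flow_value_across[OF f, of "{x}"] assms(5) by simp
    also have "\<dots> \<le> (\<Sum>e\<in>E. 1)"
    proof (rule sum_mono)
      fix e assume "e \<in> E"
      then have "\<bar>f e\<bar> \<le> 1" using f by (simp add: flow_of_value_def)
      then show "f e * (of_bool (src e \<in> {x}) - of_bool (dst e \<in> {x})) \<le> 1"
        by (auto simp: of_bool_def)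
    qed
    finally show ?thesis by simp
  qed
  ultimately obtain k where Qk: "?Q k" and k: "\<And>j. ?Q j \<Longrightarrow> j \<le> k"
    using Nat.ex_has_greatest_nat[of ?Q 0 "card E"] by metis
  from Qk obtain f where f: "flow_of_value E src dst x y k f" by blast
  define step where "step e u w \<longleftrightarrow> e \<in> E \<and> (u = src e \<and> w = dst e \<and> f e \<le> 0 \<or> u = dst e \<and> w = src e \<and> f e \<ge> 0)"
    for e u w
  have "\<nexists>es vs. dipath step x y es vs"
  proof
    assume "\<exists>es vs. dipath step x y es vs"
    then obtain p vs where p: "dipath step x y p vs" by blast
    then obtain g where g: "\<forall>e. e \<notin> set p \<longrightarrow> g e = 0"
      "\<forall>e\<in>set p. e \<in> E \<and> (g e = 1 \<and> f e \<le> 0 \<or> g e = -1 \<and> f e \<ge> 0)"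
      "\<forall>u. divergence E src dst g u = of_bool (u = x) - of_bool (u = y)"
      using dipath_unit_flow[OF p assms(2), of ends src dst, OF sd, of "\<lambda>e. f e \<le> 0" "\<lambda>e. f e \<ge> 0"] step_def by blast
    have "flow_of_value E src dst x y (Suc k) (\<lambda>e. f e + 1 * g e)"
      unfolding flow_of_value_def divergence_add
    proof (intro conjI ballI allI)
      show "\<bar>f e + 1 * g e\<bar> \<le> 1" if "e \<in> E" for e
      proof -
        have "\<bar>f e\<bar> \<le> 1" using f that by (auto simp: flow_of_value_def)
        moreover have "g e = 0 \<or> g e = 1 \<and> f e \<le> 0 \<or> g e = -1 \<and> f e \<ge> 0" using g(1,2) by blast
        ultimately show ?thesis by auto
      qed
      show "divergence E src dst f u + 1 * divergence E src dst g u =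
         int (Suc k) * (of_bool (u = x) - of_bool (u = y))" for u
      proof -
        have *: "divergence E src dst f u = int k * (of_bool (u = x) - of_bool (u = y))"
          using f by (simp add: flow_of_value_def)
        show ?thesis unfolding * g(3)[rule_format] by (simp add: algebra_simps)
      qed
    qed
    then have "?Q (Suc k)" by (intro exI)
    then have "Suc k \<le> k" by (rule k)
    then show False by simp
  qed
  then obtain S where S: "x \<in> S" "y \<notin> S" "\<And>e u w. step e u w \<Longrightarrow> u \<in> S \<Longrightarrow> w \<in> S"
    using dipath_or_closed[of step x y] by metis
  \<comment> \<open>Closure under residual steps saturates every crossing edge in the outward
    direction, so each contributes exactly 1. \<open>S\<close> may be infinite, hence the
    intersection with \<open>V\<close> before summing.\<close>
  have "f e * (of_bool (src e \<in> S \<inter> V) - of_bool (dst e \<in> S \<inter> V)) = of_bool (e \<in> cut E ends S)"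
    if "e \<in> E" for e
  proof -
    have "src e \<in> V" "dst e \<in> V" using sd[OF that] ends[OF that] by auto
    moreover have "\<bar>f e\<bar> \<le> 1" using f that by (auto simp: flow_of_value_def)
    moreover have "src e \<in> S \<Longrightarrow> dst e \<notin> S \<Longrightarrow> \<not> f e \<le> 0" "dst e \<in> S \<Longrightarrow> src e \<notin> S \<Longrightarrow> \<not> f e \<ge> 0"
      using S(3)[of e "src e" "dst e"] S(3)[of e "dst e" "src e"] that by (auto simp: step_def)
    ultimately show ?thesis
      using that sd[OF that] by (auto simp: of_bool_def cut_def)
  qed
  then have "int k = (\<Sum>e\<in>E. of_bool (e \<in> cut E ends S))"
    using flow_value_across[OF f, of "S \<inter> V"] S assms by simp
  also have "\<dots> = int (card (cut E ends S))"
    using assms(2) by (simp add: of_bool_def sum.If_cases cut_def Int_def)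
  finally have "k = card (cut E ends S)" by simp
  moreover have "\<exists>P. finite P \<and> card P = k \<and>
    (\<forall>p\<in>P. is_path E ends x y p \<and> p \<noteq> [] \<and> (\<forall>e\<in>set p. f e \<noteq> 0)) \<and>
    (\<forall>p\<in>P. \<forall>p'\<in>P. p \<noteq> p' \<longrightarrow> set p \<inter> set p' = {})"
    by (rule flow_decomposition[of V E ends src dst, OF assms(1,2) sd _ assms(4,5) f])
      (use ends in auto)
  then obtain P where "finite P" "card P = k"
    "\<forall>p\<in>P. is_path E ends x y p \<and> p \<noteq> [] \<and> (\<forall>e\<in>set p. f e \<noteq> 0)"
    "\<forall>p\<in>P. \<forall>p'\<in>P. p \<noteq> p' \<longrightarrow> set p \<inter> set p' = {}"
    by (elim exE conjE) (rule that)
  ultimately show thesis using S by (intro that[of S P]) auto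
qed

text \<open>Disjoint nonempty paths have different first edges. The bound makes the set under
  \<open>Max\<close> in \<open>local_edge_conn\<close> finite, without which nothing could be
  compared with that maximum.\<close>

lemma disjoint_paths_card_le:
  assumes "finite E" "x \<noteq> y" "P \<subseteq> {p. is_path E ends x y p}"
    "\<forall>p\<in>P. \<forall>p'\<in>P. p \<noteq> p' \<longrightarrow> set p \<inter> set p' = {}"
  shows "card P \<le> card E"
proof (rule card_inj_on_le[of hd])
  have ne: "p \<noteq> [] \<and> hd p \<in> E" if p: "p \<in> P" for p
  proof -
    obtain vs where vs: "length vs = Suc (length p)" "vs ! 0 = x" "last vs = y"
      "\<forall>i<length p. p ! i \<in> E" using p assms(3) unfolding is_path_def by blast
    have "p \<noteq> []" using vs assms(2) by (auto simp: length_Suc_conv)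
    then show ?thesis using vs(4) by (auto simp: hd_conv_nth)
  qed
  show "inj_on hd P"
  proof (rule inj_onI)
    fix p p' assume "p \<in> P" "p' \<in> P" "hd p = hd p'"
    then show "p = p'" using assms(4) ne by (metis disjoint_iff hd_in_set)
  qed
  show "hd ` P \<subseteq> E" using ne by auto
qed fact

text \<open>The path family that Menger's theorem supplies with the cut is one of those counted by
  \<open>local_edge_conn\<close>, so the size of the cut is bounded by the maximum.\<close>

lemma maxmaxflow_cut:
  assumes "wf_graph V E ends" "loopless E ends" "maxmaxflow V E ends \<le> L" "x \<in> V" "y \<in> V" "x \<noteq> y"
  obtains S where "x \<in> S" "y \<notin> S" "card (cut E ends S) \<le> L"
proof -
  have fin: "finite V" "finite E" and ends: "\<And>e. e \<in> E \<Longrightarrow> ends e \<subseteq> V \<and> card (ends e) = 2"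
    using assms(1,2) by (auto simp: wf_graph_def loopless_def)
  obtain S P where SP: "x \<in> S" "y \<notin> S" "finite P" "card P = card (cut E ends S)"
    "\<forall>p\<in>P. is_path E ends x y p" "\<forall>p\<in>P. \<forall>p'\<in>P. p \<noteq> p' \<longrightarrow> set p \<inter> set p' = {}"
    by (rule menger_edge[of V E ends x y, OF fin ends assms(4,6)])
  let ?A = "\<lambda>x y. {card P | P. P \<subseteq> {p. is_path E ends x y p} \<and>
      (\<forall>p\<in>P. \<forall>p'\<in>P. p \<noteq> p' \<longrightarrow> set p \<inter> set p' = {})}"
  have "?A x y \<subseteq> {..card E}" using disjoint_paths_card_le[OF fin(2) assms(6)] by fastforce
  then have "finite (?A x y)" using finite_subset by blast
  moreover have "card P \<in> ?A x y" using SP(5,6) by blast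
  ultimately have "card P \<le> local_edge_conn E ends x y"
    unfolding local_edge_conn_def by (rule Max_ge)
  moreover have "card V \<ge> 2"
  proof -
    have "card {x, y} \<le> card V" using assms fin by (intro card_mono) auto
    then show ?thesis using assms by simp
  qed
  moreover have "finite {local_edge_conn E ends x y | x y. x \<in> V \<and> y \<in> V \<and> x \<noteq> y}"
    by (rule finite_subset[of _ "(\<lambda>(x, y). local_edge_conn E ends x y) ` (V \<times> V)"]) (use fin in auto)
  then have "local_edge_conn E ends x y \<le> Max {local_edge_conn E ends x y | x y. x \<in> V \<and> y \<in> V \<and> x \<noteq> y}"
    using assms by (intro Max_ge) auto
  ultimately have "card (cut E ends S) \<le> L" using SP(4) assms(3) by (simp add: maxmaxflow_def)
  then show thesis using SP(1,2) by (intro that[of S])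
qed

section \<open>Connected components\<close>

lemma sym_adj: "sym (adj ends A)"
  unfolding adj_def sym_def by (auto simp: insert_commute)

lemma rtrancl_adj_sym: "(x, y) \<in> (adj ends A)\<^sup>* \<Longrightarrow> (y, x) \<in> (adj ends A)\<^sup>*"
  using sym_rtrancl[OF sym_adj] by (meson symD)

lemma equiv_connected: "equiv V (Restr ((adj ends A)\<^sup>*) V)"
  by (rule equivI) (auto simp: refl_on_def sym_def trans_def intro: rtrancl_adj_sym)

lemma adj_insert: "ends e = {a, b} \<Longrightarrow> adj ends (insert e A) = insert (a, b) (insert (b, a) (adj ends A))"
  unfolding adj_def by (auto simp: doubleton_eq_iff)

lemma rtrancl_adj_insert:
  assumes "ends e = {a, b}"
  shows "(x, y) \<in> (adj ends (insert e A))\<^sup>* \<longleftrightarrow> (x, y) \<in> (adj ends A)\<^sup>* \<or>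
    (x, a) \<in> (adj ends A)\<^sup>* \<and> (b, y) \<in> (adj ends A)\<^sup>* \<or>
    (x, b) \<in> (adj ends A)\<^sup>* \<and> (a, y) \<in> (adj ends A)\<^sup>*"
  unfolding adj_insert[of ends e a b, OF assms] rtrancl_insert
  by (auto intro: rtrancl_trans)

lemma num_components_insert_connected:
  assumes "ends e = {a, b}" "(a, b) \<in> (adj ends A)\<^sup>*"
  shows "num_components V ends (insert e A) = num_components V ends A"
proof -
  have "(adj ends (insert e A))\<^sup>* = (adj ends A)\<^sup>*"
    using assms rtrancl_adj_sym[OF assms(2)] rtrancl_adj_insert[of ends e a b, OF assms(1)]
    by (auto intro: rtrancl_trans)
  then show ?thesis by (simp add: num_components_def)
qed

text \<open>The quotient changes only in that the distinct classes of \<open>a\<close> and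
  \<open>b\<close> are replaced by their union.\<close>

lemma num_components_insert_bridge:
  assumes "ends e = {a, b}" "(a, b) \<notin> (adj ends A)\<^sup>*" "finite V" "a \<in> V" "b \<in> V"
  shows "num_components V ends A = Suc (num_components V ends (insert e A))"
proof -
  let ?R = "Restr ((adj ends A)\<^sup>*) V" and ?R' = "Restr ((adj ends (insert e A))\<^sup>*) V"
  have eq: "equiv V ?R" and eq': "equiv V ?R'" by (rule equiv_connected)+
  have ne: "?R `` {a} \<noteq> ?R `` {b}"
    using assms eq_equiv_class[OF _ eq] by blast
  have cls: "?R' `` {x} = (if x \<in> ?R `` {a} \<union> ?R `` {b} then ?R `` {a} \<union> ?R `` {b} else ?R `` {x})"
    if "x \<in> V" for x
  proof -
    have 1: "(x, a) \<in> (adj ends A)\<^sup>* \<longleftrightarrow> (a, x) \<in> (adj ends A)\<^sup>*"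
      "(x, b) \<in> (adj ends A)\<^sup>* \<longleftrightarrow> (b, x) \<in> (adj ends A)\<^sup>*"
      using rtrancl_adj_sym by metis+
    have "y \<in> ?R' `` {x} \<longleftrightarrow> y \<in> (if x \<in> ?R `` {a} \<union> ?R `` {b} then ?R `` {a} \<union> ?R `` {b} else ?R `` {x})"
      for y
    proof (cases "(a, x) \<in> (adj ends A)\<^sup>* \<or> (b, x) \<in> (adj ends A)\<^sup>*")
      case True
      then have "(x, y) \<in> (adj ends (insert e A))\<^sup>* \<longleftrightarrow> (a, y) \<in> (adj ends A)\<^sup>* \<or> (b, y) \<in> (adj ends A)\<^sup>*"
        unfolding rtrancl_adj_insert[of ends e a b, OF assms(1)] 1
        using rtrancl_adj_sym[of _ _ ends A] by (meson rtrancl_trans)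
      then show ?thesis using True that assms by auto
    next
      case False
      then have "(x, y) \<in> (adj ends (insert e A))\<^sup>* \<longleftrightarrow> (x, y) \<in> (adj ends A)\<^sup>*"
        unfolding rtrancl_adj_insert[of ends e a b, OF assms(1)] 1 by blast
      then show ?thesis using False that assms by auto
    qed
    then show ?thesis by blast
  qed
  let ?Q = "V // ?R" and ?C = "?R `` {a} \<union> ?R `` {b}"
  have ab: "?R `` {a} \<in> ?Q" "?R `` {b} \<in> ?Q" using assms by (auto intro: quotientI)
  have fin: "finite ?Q" using assms(3) eq by (intro finite_quotient) (auto)
  have mem: "a \<in> ?R `` {a}" "b \<in> ?R `` {b}" using assms by auto
  \<comment> \<open>The union is not already among the remaining classes: a class other than that of
    \<open>a\<close> is disjoint from it, but the union contains \<open>a\<close>.\<close>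
  have "?C \<notin> ?Q - {?R `` {a}, ?R `` {b}}"
  proof
    assume C: "?C \<in> ?Q - {?R `` {a}, ?R `` {b}}"
    then have "?C = ?R `` {a} \<or> ?C \<inter> ?R `` {a} = {}"
      using quotient_disj[OF eq] ab by blast
    with C mem show False by blast
  qed
  moreover have "V // ?R' = insert ?C (?Q - {?R `` {a}, ?R `` {b}})"
  proof (intro set_eqI iffI)
    fix K assume "K \<in> V // ?R'"
    then obtain x where x: "x \<in> V" "K = ?R' `` {x}" by (auto elim: quotientE)
    show "K \<in> insert ?C (?Q - {?R `` {a}, ?R `` {b}})"
    proof (cases "x \<in> ?C")
      case False
      then have "?R `` {x} \<noteq> ?R `` {a}" "?R `` {x} \<noteq> ?R `` {b}" using x(1) by blast+
      moreover have "K = ?R `` {x}" using x(2) unfolding cls[OF x(1)] if_not_P[OF False] .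
      moreover have "?R `` {x} \<in> ?Q" using x(1) by (rule quotientI)
      ultimately show ?thesis by simp
    qed (use x cls[OF x(1)] in auto)
  next
    fix K assume "K \<in> insert ?C (?Q - {?R `` {a}, ?R `` {b}})"
    then consider "K = ?C" | "K \<in> ?Q" "K \<noteq> ?R `` {a}" "K \<noteq> ?R `` {b}" by blast
    then show "K \<in> V // ?R'"
    proof cases
      case 1
      then have "K = ?R' `` {a}" using cls[OF assms(4)] mem by auto
      then show ?thesis using assms by (auto intro: quotientI)
    next
      case 2
      then obtain x where x: "x \<in> V" "K = ?R `` {x}" by (auto elim: quotientE)
      have "x \<notin> ?R `` {a}" "x \<notin> ?R `` {b}"
        using 2 x equiv_class_eq[OF eq] by blast+
      then have nC: "x \<notin> ?C" by blast
      have "K = ?R' `` {x}" unfolding cls[OF x(1)] if_not_P[OF nC] by (rule x(2))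
      then show ?thesis using x by (auto intro: quotientI)
    qed
  qed
  ultimately have "card (V // ?R') = Suc (card (?Q - {?R `` {a}, ?R `` {b}}))"
    using fin by simp
  also have "card (?Q - {?R `` {a}, ?R `` {b}}) = card ?Q - 2"
    using ab ne by (subst card_Diff_subset) auto
  finally have "card (V // ?R') = Suc (card ?Q - 2)" .
  moreover have "card {?R `` {a}, ?R `` {b}} \<le> card ?Q" using ab fin by (intro card_mono) auto
  ultimately show ?thesis using ne by (simp add: num_components_def)
qed

lemma num_components_isolated:
  assumes "finite V" "w \<notin> V" "\<And>e. e \<in> A \<Longrightarrow> ends e \<subseteq> V"
  shows "num_components (insert w V) ends A = Suc (num_components V ends A)"
proof -
  let ?r = "(adj ends A)\<^sup>*"
  have adjV: "adj ends A \<subseteq> V \<times> V" using assms(3) by (auto simp: adj_def)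
  have 1: "(w, y) \<in> ?r \<longleftrightarrow> y = w" "(y, w) \<in> ?r \<longleftrightarrow> y = w" for y
    using adjV assms(2) by (auto elim: rtranclE converse_rtranclE)
  have w: "Restr ?r (insert w V) = insert (w, w) (Restr ?r V)" using 1 by auto
  have img: "insert (w, w) (Restr ?r V) `` {x} = Restr ?r V `` {x}" if "x \<in> V" for x
    using that assms(2) by auto
  have "insert w V // Restr ?r (insert w V) = insert {w} (V // Restr ?r V)"
    unfolding w quotient_def using img assms(2) by auto
  moreover have "{w} \<notin> V // Restr ?r V" using assms(2) by (auto elim!: quotientE)
  moreover have "finite (V // Restr ?r V)" using assms(1) by (intro finite_quotient) auto
  ultimately show ?thesis by (simp add: num_components_def)
qed

lemma num_components_empty: "num_components V ends {} = card V"
proof -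
  have "Restr ((adj ends {})\<^sup>*) V = Id_on V" by (auto simp: adj_def)
  then have "V // Restr ((adj ends {})\<^sup>*) V = (\<lambda>x. {x}) ` V"
    by (auto simp: quotient_def)
  then show ?thesis by (simp add: num_components_def card_image)
qed

text \<open>Adjacency depends only on the set of endpoint pairs, so it does not see whether an edge
  is present once or twice; this is what parallel reduction needs.\<close>

lemma adj_eq_image: "adj ends A = {(u, w). {u, w} \<in> ends ` A}"
  by (force simp: adj_def)

lemma adj_image_cong: "ends ` A = ends' ` A' \<Longrightarrow> adj ends A = adj ends' A'"
  by (simp add: adj_eq_image)

lemma adj_cong: "(\<And>e. e \<in> A \<Longrightarrow> ends e = ends' e) \<Longrightarrow> adj ends A = adj ends' A"
  by (auto simp: adj_def)

lemma num_components_cong: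
  "(\<And>e. e \<in> A \<Longrightarrow> ends e = ends' e) \<Longrightarrow> num_components V ends A = num_components V ends' A"
  using adj_cong[of A ends ends'] by (simp add: num_components_def)

section \<open>Series and parallel reduction\<close>

lemma cut_cong: "(\<And>e. e \<in> E \<Longrightarrow> ends e = ends' e) \<Longrightarrow> cut E ends S = cut E ends' S"
  by (auto simp: cut_def)

lemma cut_subset: "cut E ends S \<subseteq> E"
  by (auto simp: cut_def)

lemma cut_empty_connected:
  assumes "(x, y) \<in> (adj ends A)\<^sup>*" "cut A ends S = {}"
  shows "x \<in> S \<longleftrightarrow> y \<in> S"
  using assms(1)
proof induction
  case (step y z)
  then obtain e where "e \<in> A" "ends e = {y, z}" by (auto simp: adj_def)
  then have "y \<in> S \<longleftrightarrow> z \<in> S" using assms(2) by (auto simp: cut_def)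
  with step show ?case by simp
qed simp

lemma bridge_disconnects:
  assumes "bridge (insert e E) ends e" "e \<notin> E" "A \<subseteq> E" "ends e = {a, b}"
  shows "(a, b) \<notin> (adj ends A)\<^sup>*"
proof
  assume ab: "(a, b) \<in> (adj ends A)\<^sup>*"
  obtain S where S: "cut (insert e E) ends S = {e}" using assms(1) by (auto simp: bridge_def)
  then have "cut A ends S = {}" using assms(2,3) by (auto simp: cut_def)
  then have "a \<in> S \<longleftrightarrow> b \<in> S" using cut_empty_connected[OF ab] by blast
  moreover have "e \<in> cut (insert e E) ends S" using S by simp
  ultimately show False using assms(4) by (auto simp: cut_def)
qed

lemma bridge_subset:
  assumes "bridge E ends e" "F \<subseteq> E" "e \<in> F"
  shows "bridge F ends e"
proof -
  obtain S where "cut E ends S = {e}" using assms(1) by (auto simp: bridge_def)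
  then have "cut F ends S = {e}" using assms(2,3) by (auto simp: cut_def)
  then show ?thesis by (auto simp: bridge_def)
qed

text \<open>A simple path between the ends of \<open>e\<close> that avoids \<open>e\<close> would
  close up with \<open>e\<close> to a cycle. The cut is therefore the set closed under the edges
  other than \<open>e\<close>.\<close>

lemma forest_bridge:
  assumes "is_forest V E ends" "e \<in> E"
  shows "bridge E ends e"
proof -
  have "card (ends e) = 2" using assms by (auto simp: is_forest_def loopless_def)
  then obtain a b where ab: "ends e = {a, b}" "a \<noteq> b" by (auto simp: card_2_iff)
  define step where "step f u w \<longleftrightarrow> f \<in> E - {e} \<and> ends f = {u, w}" for f u w
  have "\<nexists>es vs. dipath step b a es vs"
  proof
    assume "\<exists>es vs. dipath step b a es vs"
    then obtain es vs where p: "dipath step b a es vs" by blast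
    have "length vs = Suc (length es) \<and> vs ! 0 = b \<and> last vs = a \<and> distinct vs \<and>
      (\<forall>i<length es. es ! i \<in> E - {e} \<and> ends (es ! i) = {vs ! i, vs ! Suc i})"
      by (rule dipath_imp_vertex_list[OF p]) (simp add: step_def)
    then have vs: "length vs = Suc (length es)" "vs ! 0 = b" "last vs = a" "distinct vs"
      "\<And>i. i < length es \<Longrightarrow> es ! i \<in> E - {e} \<and> ends (es ! i) = {vs ! i, vs ! Suc i}" by auto
    have des: "distinct es" by (rule dipath_distinct[OF p, of ends]) (simp add: step_def)
    have "e \<notin> set es" using vs(5) by (metis Diff_iff in_set_conv_nth insertI1)
    moreover have "(e # es) ! i \<in> E \<and> ends ((e # es) ! i) = {(a # vs) ! i, (a # vs) ! Suc i}"
      if "i < length (e # es)" for i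
      using that vs(2,5) ab(1) assms(2) by (cases i) auto
    moreover have "last (a # vs) = a" using vs(1,3) by auto
    ultimately have "is_cycle E ends (e # es)"
      unfolding is_cycle_def using des vs(1,4) by (intro conjI exI[of _ "a # vs"]) auto
    then show False using assms(1) by (auto simp: is_forest_def)
  qed
  then obtain S where S: "b \<in> S" "a \<notin> S" "\<And>f u w. step f u w \<Longrightarrow> u \<in> S \<Longrightarrow> w \<in> S"
    using dipath_or_closed[of step b a] by metis
  have "f \<notin> cut E ends S" if f: "f \<in> E" "f \<noteq> e" for f
  proof -
    have "card (ends f) = 2" using assms f by (auto simp: is_forest_def loopless_def)
    then obtain u w where "ends f = {u, w}" by (auto simp: card_2_iff)
    moreover from this have "step f u w" "step f w u" using f by (auto simp: step_def)
    ultimately show ?thesis using S(3) by (auto simp: cut_def)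
  qed
  moreover have "e \<in> cut E ends S" using S ab assms(2) by (auto simp: cut_def)
  ultimately have "cut E ends S = {e}" using cut_subset[of E ends S] by blast
  then show ?thesis by (auto simp: bridge_def)
qed

text \<open>The transmissivity \<open>t = v / (q + v)\<close> turns the weights \<open>v\<close> and \<open>1\<close> of a present and an
  absent edge into \<open>t\<close> and \<open>(1 - t) / q\<close> (up to the factor \<open>q + v\<close>); in this normalization
  series reduction needs no prefactor and is valid for all complex \<open>t\<close>.\<close>

definition trans_weight :: "'e set \<Rightarrow> complex \<Rightarrow> ('e \<Rightarrow> complex) \<Rightarrow> 'e set \<Rightarrow> complex" where
  "trans_weight E q t A = (\<Prod>e\<in>A. t e) * (\<Prod>e\<in>E - A. (1 - t e) / q)"

definition transZ :: "'v set \<Rightarrow> 'e set \<Rightarrow> ('e \<Rightarrow> 'v set) \<Rightarrow> complex \<Rightarrow> ('e \<Rightarrow> complex) \<Rightarrow> complex" where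
  "transZ V E ends q t = (\<Sum>A\<in>Pow E. q ^ num_components V ends A * trans_weight E q t A)"

lemma trans_weight_absent:
  assumes "finite E" "e \<notin> E" "A \<subseteq> E"
  shows "trans_weight (insert e E) q t A = (1 - t e) / q * trans_weight E q t A"
proof -
  have "insert e E - A = insert e (E - A)" using assms by auto
  then show ?thesis using assms by (simp add: trans_weight_def)
qed

lemma trans_weight_present:
  assumes "finite E" "e \<notin> E" "A \<subseteq> E"
  shows "trans_weight (insert e E) q t (insert e A) = t e * trans_weight E q t A"
proof -
  have "insert e E - insert e A = E - A" "e \<notin> A" "finite A" using assms finite_subset by auto
  then show ?thesis by (simp add: trans_weight_def)
qed

lemma trans_weight_cong:
  "(\<And>e. e \<in> E \<Longrightarrow> t e = t' e) \<Longrightarrow> A \<subseteq> E \<Longrightarrow> trans_weight E q t A = trans_weight E q t' A"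
  by (auto simp: trans_weight_def intro!: arg_cong2[of _ _ _ _ "(*)"] prod.cong)

lemma sum_Pow_insert:
  assumes "finite E" "e \<notin> E"
  shows "(\<Sum>A\<in>Pow (insert e E). g A) = (\<Sum>A\<in>Pow E. g A + g (insert e A))"
proof -
  have "inj_on (insert e) (Pow E)" using assms(2) by (auto simp: inj_on_def)
  moreover have "Pow E \<inter> insert e ` Pow E = {}" using assms(2) by auto
  ultimately show ?thesis
    using assms(1) by (simp add: Pow_insert sum.union_disjoint sum.reindex sum.distrib)
qed

lemma transZ_insert:
  assumes "finite E" "e \<notin> E"
  shows "transZ V (insert e E) ends q t =
    (\<Sum>A\<in>Pow E. (q ^ num_components V ends A * ((1 - t e) / q) +
      q ^ num_components V ends (insert e A) * t e) * trans_weight E q t A)"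
  unfolding transZ_def sum_Pow_insert[OF assms]
  by (intro sum.cong refl) (simp add: trans_weight_absent trans_weight_present assms algebra_simps)

lemma transZ_insert2:
  assumes "finite E" "e1 \<notin> E" "e2 \<notin> E" "e1 \<noteq> e2"
  shows "transZ V (insert e1 (insert e2 E)) ends q t =
    (\<Sum>A\<in>Pow E. (q ^ num_components V ends A * ((1 - t e1) / q) * ((1 - t e2) / q) +
      q ^ num_components V ends (insert e1 A) * t e1 * ((1 - t e2) / q) +
      q ^ num_components V ends (insert e2 A) * ((1 - t e1) / q) * t e2 +
      q ^ num_components V ends (insert e1 (insert e2 A)) * t e1 * t e2) * trans_weight E q t A)"
proof -
  have "finite (insert e2 E)" "e1 \<notin> insert e2 E" using assms by auto
  note transZ_insert[OF this]
  also have "(\<Sum>A\<in>Pow (insert e2 E). (q ^ num_components V ends A * ((1 - t e1) / q) +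
      q ^ num_components V ends (insert e1 A) * t e1) * trans_weight (insert e2 E) q t A) =
    (\<Sum>A\<in>Pow E. (q ^ num_components V ends A * ((1 - t e1) / q) +
      q ^ num_components V ends (insert e1 A) * t e1) * ((1 - t e2) / q * trans_weight E q t A) +
      (q ^ num_components V ends (insert e2 A) * ((1 - t e1) / q) +
      q ^ num_components V ends (insert e1 (insert e2 A)) * t e1) * (t e2 * trans_weight E q t A))"
    unfolding sum_Pow_insert[OF assms(1,3)]
    by (intro sum.cong refl)
      (simp only: Pow_iff trans_weight_absent[OF assms(1,3)] trans_weight_present[OF assms(1,3)])
  also have "\<dots> = (\<Sum>A\<in>Pow E. (q ^ num_components V ends A * ((1 - t e1) / q) * ((1 - t e2) / q) +
      q ^ num_components V ends (insert e1 A) * t e1 * ((1 - t e2) / q) +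
      q ^ num_components V ends (insert e2 A) * ((1 - t e1) / q) * t e2 +
      q ^ num_components V ends (insert e1 (insert e2 A)) * t e1 * t e2) * trans_weight E q t A)"
    by (intro sum.cong refl) (simp only: distrib_left distrib_right mult.assoc mult.commute mult.left_commute add.assoc)
  finally show ?thesis .
qed

text \<open>Inserting a bridge always lowers the number of components by one, so the two states
  contribute \<open>q^k * (1 - t) / q + q^(k-1) * t = q^(k-1)\<close>, and \<open>t\<close>
  cancels.\<close>

lemma transZ_bridge:
  assumes "finite V" "finite E" "e \<notin> E" "bridge (insert e E) ends e" "ends e \<subseteq> V"
    "card (ends e) = 2" "q \<noteq> 0"
  shows "transZ V (insert e E) ends q t = transZ V E ends q t / q"
proof -
  obtain a b where ab: "ends e = {a, b}" using assms(6) by (auto simp: card_2_iff)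
  have k: "num_components V ends A = Suc (num_components V ends (insert e A))" if "A \<subseteq> E" for A
    using num_components_insert_bridge[of ends e a b, OF ab bridge_disconnects[OF assms(4,3) that ab] assms(1)]
      ab assms(5) by simp
  have "transZ V (insert e E) ends q t =
    (\<Sum>A\<in>Pow E. q ^ num_components V ends A * trans_weight E q t A / q)"
    unfolding transZ_insert[OF assms(2,3)]
    using assms(7) by (intro sum.cong refl) (simp add: k field_simps)
  then show ?thesis by (simp add: transZ_def sum_divide_distrib)
qed

text \<open>A bridge remains one in every smaller edge set that contains it, so the edges can be
  peeled off in any order.\<close>

lemma transZ_all_bridges:
  assumes "finite V" "finite E" "\<And>e. e \<in> E \<Longrightarrow> bridge E ends e" "wf_graph V E ends" "loopless E ends"
    "q \<noteq> 0"
  shows "transZ V E ends q t = q ^ card V / q ^ card E"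
  using assms(2-5)
proof (induction E rule: finite_induct)
  case empty
  then show ?case by (simp add: transZ_def trans_weight_def num_components_empty)
next
  case (insert e E)
  have "transZ V (insert e E) ends q t = transZ V E ends q t / q"
    using insert assms(1,6)
    by (intro transZ_bridge) (auto simp: wf_graph_def loopless_def)
  moreover have "transZ V E ends q t = q ^ card V / q ^ card E"
    using insert.prems(2,3) bridge_subset[OF insert.prems(1), of _ E]
    by (intro insert.IH) (auto simp: wf_graph_def loopless_def)
  ultimately show ?case using insert.hyps by (simp add: mult.commute)
qed

text \<open>With \<open>k\<close> the number of components on the old vertices, the three states in
  which \<open>e1\<close> or \<open>e2\<close> is absent sum to
  \<open>q^k * (1 - t e1 * t e2) / q\<close>, the extra \<open>q\<close> from the isolated
  \<open>w\<close> compensating the second denominator. Both edges present act as \<open>e\<close>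
  present, with weight \<open>t e1 * t e2\<close>.\<close>

lemma transZ_series:
  assumes "finite V" "finite E" "e \<notin> E" "ends e = {a, b}" "a \<in> V" "b \<in> V" "w \<notin> V"
    "\<And>e. e \<in> E \<Longrightarrow> ends e \<subseteq> V" "e1 \<noteq> e2" "e1 \<notin> E" "e2 \<notin> E" "q \<noteq> 0"
  shows "transZ (insert w V) (insert e1 (insert e2 E)) (ends(e1 := {a, w}, e2 := {w, b})) q t =
    transZ V (insert e E) ends q (t(e := t e1 * t e2))"
proof -
  let ?V = "insert w V" and ?ends = "ends(e1 := {a, w}, e2 := {w, b})"
  have ends1: "?ends e1 = {a, w}" and ends2: "?ends e2 = {w, b}" using assms(9) by auto
  have wa: "w \<noteq> a" "w \<noteq> b" using assms by auto
  have k: "num_components ?V ?ends A = Suc (num_components V ends A)"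
    "num_components ?V ?ends (insert e1 A) = num_components V ends A"
    "num_components ?V ?ends (insert e2 A) = num_components V ends A"
    "num_components ?V ?ends (insert e1 (insert e2 A)) = num_components V ends (insert e A)"
    if A: "A \<subseteq> E" for A
  proof -
    have adjA: "adj ?ends A = adj ends A"
      using A assms(10,11) by (intro adj_cong) auto
    have AV: "ends e \<subseteq> V" if "e \<in> A" for e using A assms(8) that by blast
    have "num_components ?V ?ends A = num_components ?V ends A"
      by (simp add: num_components_def adjA)
    also have "\<dots> = Suc (num_components V ends A)"
      by (rule num_components_isolated[of V w A ends]) (use assms AV in auto)
    finally show k0: "num_components ?V ?ends A = Suc (num_components V ends A)" .
    have "adj ends A \<subseteq> V \<times> V" using AV by (auto simp: adj_def)
    then have w: "(w, y) \<in> (adj ends A)\<^sup>* \<longleftrightarrow> y = w" "(y, w) \<in> (adj ends A)\<^sup>* \<longleftrightarrow> y = w" for y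
      using assms(7) by (auto elim: rtranclE converse_rtranclE)
    have "num_components ?V ?ends A = Suc (num_components ?V ?ends (insert e1 A))"
      by (rule num_components_insert_bridge[of ?ends e1 a w]) (use assms ends1 wa adjA w in auto)
    then show "num_components ?V ?ends (insert e1 A) = num_components V ends A" using k0 by simp
    have "num_components ?V ?ends A = Suc (num_components ?V ?ends (insert e2 A))"
      by (rule num_components_insert_bridge[of ?ends e2 w b]) (use assms ends2 wa adjA w in auto)
    then show k2: "num_components ?V ?ends (insert e2 A) = num_components V ends A" using k0 by simp
    \<comment> \<open>With \<open>e2\<close> present, \<open>w\<close> is just an appendage of
      \<open>b\<close>; the edge \<open>e1\<close> then plays the part of \<open>e\<close>.\<close>
    have aw: "(a, w) \<in> (adj ?ends (insert e2 A))\<^sup>* \<longleftrightarrow> (a, b) \<in> (adj ends A)\<^sup>*"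
      unfolding rtrancl_adj_insert[of ?ends e2 w b, OF ends2] adjA using w wa by auto
    show "num_components ?V ?ends (insert e1 (insert e2 A)) = num_components V ends (insert e A)"
    proof (cases "(a, b) \<in> (adj ends A)\<^sup>*")
      case True
      then have "num_components ?V ?ends (insert e1 (insert e2 A)) = num_components ?V ?ends (insert e2 A)"
        using aw by (intro num_components_insert_connected[of ?ends e1 a w, OF ends1]) simp
      moreover have "num_components V ends (insert e A) = num_components V ends A"
        by (rule num_components_insert_connected[of ends e a b, OF assms(4) True])
      ultimately show ?thesis using k2 by simp
    next
      case False
      have "num_components ?V ?ends (insert e2 A) = Suc (num_components ?V ?ends (insert e1 (insert e2 A)))"
        by (rule num_components_insert_bridge[of ?ends e1 a w, OF ends1]) (use assms False aw in auto)
      moreover have "num_components V ends A = Suc (num_components V ends (insert e A))"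
        by (rule num_components_insert_bridge[of ends e a b, OF assms(4) False]) (use assms in auto)
      ultimately show ?thesis using k2 by simp
    qed
  qed
  show ?thesis
    unfolding transZ_insert2[OF assms(2,10,11,9)] transZ_insert[OF assms(2,3)]
  proof (intro sum.cong refl)
    fix A assume "A \<in> Pow E"
    then have A: "A \<subseteq> E" by simp
    have "trans_weight E q t A = trans_weight E q (t(e := t e1 * t e2)) A"
      using A assms(3) by (intro trans_weight_cong) auto
    then show "(q ^ num_components ?V ?ends A * ((1 - t e1) / q) * ((1 - t e2) / q) +
        q ^ num_components ?V ?ends (insert e1 A) * t e1 * ((1 - t e2) / q) +
        q ^ num_components ?V ?ends (insert e2 A) * ((1 - t e1) / q) * t e2 +
        q ^ num_components ?V ?ends (insert e1 (insert e2 A)) * t e1 * t e2) * trans_weight E q t A =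
      (q ^ num_components V ends A * ((1 - (t(e := t e1 * t e2)) e) / q) +
        q ^ num_components V ends (insert e A) * (t(e := t e1 * t e2)) e) *
        trans_weight E q (t(e := t e1 * t e2)) A"
      unfolding k[OF A] using assms(12) by (simp add: field_simps)
  qed
qed

text \<open>The effective edge is absent exactly when both edges are. Matching the weights of the
  two states gives \<open>d * (1 - s) = (1 - t e1) * (1 - t e2)\<close> and
  \<open>d * s = t e1 + t e2 + (q - 2) * (t e1 * t e2)\<close>; their sum forces
  \<open>d = 1 + (q - 1) * (t e1 * t e2)\<close>, the factor that has to be nonzero.\<close>

lemma transZ_parallel:
  assumes "finite E" "e \<notin> E" "e1 \<noteq> e2" "e1 \<notin> E" "e2 \<notin> E" "q \<noteq> 0"
    and nz: "1 + (q - 1) * (t e1 * t e2) \<noteq> 0"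
  shows "transZ V (insert e1 (insert e2 E)) (ends(e1 := ends e, e2 := ends e)) q t =
    (1 + (q - 1) * (t e1 * t e2)) / q * transZ V (insert e E) ends q
      (t(e := (t e1 + t e2 + (q - 2) * (t e1 * t e2)) / (1 + (q - 1) * (t e1 * t e2))))"
proof -
  let ?ends = "ends(e1 := ends e, e2 := ends e)"
  define d where "d = 1 + (q - 1) * (t e1 * t e2)"
  define s where "s = (t e1 + t e2 + (q - 2) * (t e1 * t e2)) / d"
  have k: "num_components V ?ends A = num_components V ends A"
    "num_components V ?ends (insert e1 A) = num_components V ends (insert e A)"
    "num_components V ?ends (insert e2 A) = num_components V ends (insert e A)"
    "num_components V ?ends (insert e1 (insert e2 A)) = num_components V ends (insert e A)"
    if A: "A \<subseteq> E" for A
  proof -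
    have nA: "e \<notin> A" "e1 \<notin> A" "e2 \<notin> A" using A assms by auto
    have im: "?ends ` A = ends ` A" using nA by (intro image_cong) auto
    have "adj ?ends A = adj ends A" "adj ?ends (insert e1 A) = adj ends (insert e A)"
      "adj ?ends (insert e2 A) = adj ends (insert e A)"
      "adj ?ends (insert e1 (insert e2 A)) = adj ends (insert e A)"
      using assms(3) by (intro adj_image_cong; simp only: image_insert im fun_upd_apply; simp)+
    then show "num_components V ?ends A = num_components V ends A"
      "num_components V ?ends (insert e1 A) = num_components V ends (insert e A)"
      "num_components V ?ends (insert e2 A) = num_components V ends (insert e A)"
      "num_components V ?ends (insert e1 (insert e2 A)) = num_components V ends (insert e A)"
      by (simp_all add: num_components_def)
  qed
  have ds: "d * s = t e1 + t e2 + (q - 2) * (t e1 * t e2)" using nz by (simp add: s_def d_def)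
  have ds1: "d * (1 - s) = (1 - t e1) * (1 - t e2)"
    using ds by (simp add: algebra_simps) (simp add: d_def algebra_simps)
  have "transZ V (insert e1 (insert e2 E)) ?ends q t = d / q * transZ V (insert e E) ends q (t(e := s))"
    unfolding transZ_insert2[OF assms(1,4,5,3)] transZ_insert[OF assms(1,2)] sum_distrib_left
  proof (intro sum.cong refl)
    fix A assume "A \<in> Pow E"
    then have A: "A \<subseteq> E" by simp
    have w: "trans_weight E q t A = trans_weight E q (t(e := s)) A"
      using A assms(2) by (intro trans_weight_cong) auto
    have 1: "d / q * ((1 - s) / q) = (1 - t e1) / q * ((1 - t e2) / q)"
      using ds1 by (simp add: divide_simps)
    have 2: "d / q * s = t e1 * ((1 - t e2) / q) + (1 - t e1) / q * t e2 + t e1 * t e2"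
    proof -
      have "d / q * s = (d * s) / q" by simp
      also have "\<dots> = t e1 * ((1 - t e2) / q) + (1 - t e1) / q * t e2 + t e1 * t e2"
        unfolding ds using assms(6) by (simp add: field_simps)
      finally show ?thesis .
    qed
    have M: "d / q * (q ^ num_components V ends A * ((1 - s) / q) + q ^ num_components V ends (insert e A) * s) =
      q ^ num_components V ends A * (d / q * ((1 - s) / q)) + q ^ num_components V ends (insert e A) * (d / q * s)"
      by (simp only: distrib_left mult.assoc mult.left_commute mult.commute)
    have *: "q ^ num_components V ends A * ((1 - t e1) / q) * ((1 - t e2) / q) +
        q ^ num_components V ends (insert e A) * t e1 * ((1 - t e2) / q) +
        q ^ num_components V ends (insert e A) * ((1 - t e1) / q) * t e2 +
        q ^ num_components V ends (insert e A) * t e1 * t e2 =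
      d / q * (q ^ num_components V ends A * ((1 - s) / q) + q ^ num_components V ends (insert e A) * s)"
      unfolding M 1 2 by (simp only: distrib_left mult.assoc add.assoc)
    show "(q ^ num_components V ?ends A * ((1 - t e1) / q) * ((1 - t e2) / q) +
        q ^ num_components V ?ends (insert e1 A) * t e1 * ((1 - t e2) / q) +
        q ^ num_components V ?ends (insert e2 A) * ((1 - t e1) / q) * t e2 +
        q ^ num_components V ?ends (insert e1 (insert e2 A)) * t e1 * t e2) * trans_weight E q t A =
      d / q * ((q ^ num_components V ends A * ((1 - (t(e := s)) e) / q) +
        q ^ num_components V ends (insert e A) * (t(e := s)) e) * trans_weight E q (t(e := s)) A)"
      unfolding k[OF A] w * by (simp add: mult.assoc)
  qed
  then show ?thesis by (simp add: s_def d_def)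
qed

lemma tutteZ_eq_transZ:
  assumes "finite E" "q \<noteq> 0" "\<And>e. e \<in> E \<Longrightarrow> q + v e \<noteq> 0"
  shows "tutteZ V E ends q v = (\<Prod>e\<in>E. q + v e) * transZ V E ends q (\<lambda>e. v e / (q + v e))"
proof -
  have "(\<Prod>e\<in>A. v e) = (\<Prod>e\<in>E. q + v e) * trans_weight E q (\<lambda>e. v e / (q + v e)) A" if A: "A \<subseteq> E" for A
  proof -
    have fin: "finite A" "finite (E - A)" using A assms(1) finite_subset by auto
    have "(1 - v e / (q + v e)) / q = 1 / (q + v e)" if "e \<in> E" for e
    proof -
      have "1 - v e / (q + v e) = q / (q + v e)" using assms(3)[OF that] by (simp add: field_simps)
      then show ?thesis using assms(2) by simp
    qed
    then have "trans_weight E q (\<lambda>e. v e / (q + v e)) A =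
      (\<Prod>e\<in>A. v e) / ((\<Prod>e\<in>A. q + v e) * (\<Prod>e\<in>E - A. q + v e))"
      by (simp add: trans_weight_def prod_dividef)
    also have "(\<Prod>e\<in>A. q + v e) * (\<Prod>e\<in>E - A. q + v e) = (\<Prod>e\<in>E. q + v e)"
      using prod.subset_diff[OF A assms(1), of "\<lambda>e. q + v e"] by (simp add: mult.commute)
    finally show ?thesis using assms(1,3) by simp
  qed
  then show ?thesis
    unfolding tutteZ_def transZ_def sum_distrib_left
    by (intro sum.cong refl) (simp add: mult.assoc mult.left_commute)
qed

section \<open>The critical radius and the disc radii\<close>

lemma ln_one_plus_le_cubic:
  assumes "0 \<le> (x::real)"
  shows "ln (1 + x) \<le> x - x\<^sup>2 / 2 + x ^ 3 / 3"
proof -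
  let ?h = "\<lambda>x::real. x - x\<^sup>2 / 2 + x ^ 3 / 3 - ln (1 + x)"
  have "?h 0 \<le> ?h x"
  proof (rule DERIV_nonneg_imp_nondecreasing[OF assms])
    fix y :: real assume y: "0 \<le> y"
    have "(?h has_real_derivative 1 - y + y\<^sup>2 - 1 / (1 + y)) (at y)"
      using y by (auto intro!: derivative_eq_intros)
    moreover have "1 - y + y\<^sup>2 - 1 / (1 + y) = y ^ 3 / (1 + y)"
      using y by (simp add: field_simps power2_eq_square power3_eq_cube)
    ultimately show "\<exists>z. (?h has_real_derivative z) (at y) \<and> 0 \<le> z" using y by auto
  qed
  then show ?thesis by simp
qed

lemma ln_one_plus_ge_quadratic:
  assumes "0 \<le> (x::real)"
  shows "x - x\<^sup>2 / 2 \<le> ln (1 + x)"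
proof -
  let ?h = "\<lambda>x::real. ln (1 + x) - (x - x\<^sup>2 / 2)"
  have "?h 0 \<le> ?h x"
  proof (rule DERIV_nonneg_imp_nondecreasing[OF assms])
    fix y :: real assume y: "0 \<le> y"
    have "(?h has_real_derivative 1 / (1 + y) - (1 - y)) (at y)"
      using y by (auto intro!: derivative_eq_intros)
    moreover have "1 / (1 + y) - (1 - y) = y\<^sup>2 / (1 + y)"
      using y by (simp add: field_simps power2_eq_square)
    ultimately show "\<exists>z. (?h has_real_derivative z) (at y) \<and> 0 \<le> z" using y by auto
  qed
  then show ?thesis by simp
qed

text \<open>The logarithm of \<open>(1 + r)^L / (2 * (1 + r^2)^(L - 1))\<close>: its derivative has
  the sign of a quadratic in \<open>r\<close>.\<close>

definition rho_gap :: "nat \<Rightarrow> real \<Rightarrow> real" where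
  "rho_gap L r = real L * ln (1 + r) - (real L - 1) * ln (1 + r\<^sup>2) - ln 2"

lemma rho_gap_ln:
  assumes "L \<ge> 1" "r > -1"
  shows "rho_gap L r = ln ((1 + r) ^ L) - ln (2 * (1 + r\<^sup>2) ^ (L - 1))"
proof -
  have "1 + r\<^sup>2 > 0" by (simp add: add_pos_nonneg)
  then show ?thesis
    using assms by (simp add: rho_gap_def ln_mult ln_realpow of_nat_diff)
qed

lemma rho_gap_sign:
  assumes "L \<ge> 1" "r > -1"
  shows "rho_gap L r = 0 \<longleftrightarrow> (1 + r) ^ L = 2 * (1 + r\<^sup>2) ^ (L - 1)"
    and "rho_gap L r \<le> 0 \<longleftrightarrow> (1 + r) ^ L \<le> 2 * (1 + r\<^sup>2) ^ (L - 1)"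
proof -
  have "(1 + r) ^ L > 0" "2 * (1 + r\<^sup>2) ^ (L - 1) > 0"
    using assms(2) by (simp_all add: add_pos_nonneg)
  then show "rho_gap L r = 0 \<longleftrightarrow> (1 + r) ^ L = 2 * (1 + r\<^sup>2) ^ (L - 1)"
    "rho_gap L r \<le> 0 \<longleftrightarrow> (1 + r) ^ L \<le> 2 * (1 + r\<^sup>2) ^ (L - 1)"
    unfolding rho_gap_ln[OF assms] by simp_all
qed

lemma rho_gap_deriv:
  assumes "r > -1"
  shows "(rho_gap L has_real_derivative
    (real L - 2 * (real L - 1) * r - (real L - 2) * r\<^sup>2) / ((1 + r) * (1 + r\<^sup>2))) (at r)"
proof -
  have p: "1 + r\<^sup>2 > 0" "1 + r > 0" using assms by (simp_all add: add_pos_nonneg)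
  have "((\<lambda>r. real L * ln (1 + r) - (real L - 1) * ln (1 + r\<^sup>2) - ln 2) has_real_derivative
    real L * (1 / (1 + r)) - (real L - 1) * (2 * r / (1 + r\<^sup>2))) (at r)"
    using p by (auto intro!: derivative_eq_intros)
  moreover have "real L * (1 / (1 + r)) - (real L - 1) * (2 * r / (1 + r\<^sup>2)) =
    (real L - 2 * (real L - 1) * r - (real L - 2) * r\<^sup>2) / ((1 + r) * (1 + r\<^sup>2))"
  proof -
    have "real L * (1 / (1 + r)) = real L * (1 + r\<^sup>2) / ((1 + r) * (1 + r\<^sup>2))"
      "(real L - 1) * (2 * r / (1 + r\<^sup>2)) = (real L - 1) * (2 * r) * (1 + r) / ((1 + r) * (1 + r\<^sup>2))"
      using p by auto
    then show ?thesis
      by (simp only: diff_divide_distrib[symmetric]) (simp add: algebra_simps power2_eq_square)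
  qed
  ultimately show ?thesis unfolding rho_gap_def[abs_def] by simp
qed

text \<open>The numerator \<open>?N\<close> of the derivative decreases from \<open>L > 0\<close> at
  0 to \<open>4 - 2 * L < 0\<close> at 1, so the gap rises up to some \<open>c\<close> and falls
  afterwards. It starts at \<open>- ln 2\<close> and ends at the trivial zero \<open>r = 1\<close>;
  hence it is positive at \<open>c\<close> and has one further zero, left of \<open>c\<close>. For
  \<open>L = 2\<close> the numerator is \<open>2 - 2 * r\<close>, so \<open>c\<close> moves to 1 and
  no interior zero is left.\<close>

lemma rho_gap_shape:
  assumes "L \<ge> 3"
  obtains s where "0 < s" "s < 1" "rho_gap L s = 0"
    "\<And>r. 0 < r \<Longrightarrow> r < s \<Longrightarrow> rho_gap L r < 0" "\<And>r. s < r \<Longrightarrow> r < 1 \<Longrightarrow> rho_gap L r > 0"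
proof -
  let ?N = "\<lambda>r. real L - 2 * (real L - 1) * r - (real L - 2) * r\<^sup>2"
  have L: "real L \<ge> 3" using assms by simp
  have cont: "continuous_on {a..b} (rho_gap L)" if "a > -1" for a b
  proof (rule continuous_at_imp_continuous_on, rule ballI)
    fix r assume "r \<in> {a..b}"
    with that show "isCont (rho_gap L) r" by (intro DERIV_isCont[OF rho_gap_deriv]) simp
  qed
  have Nmono: "?N y < ?N x" if "0 \<le> x" "x < y" for x y
  proof -
    have "(real L - 2) * x\<^sup>2 \<le> (real L - 2) * y\<^sup>2"
      using that L by (intro mult_left_mono power_mono) auto
    moreover have "2 * (real L - 1) * x < 2 * (real L - 1) * y" using that L by simp
    ultimately show ?thesis by linarith
  qed
  have "continuous_on {0..1} ?N" by (intro continuous_intros)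
  moreover have "?N 1 \<le> 0" "0 \<le> ?N 0" using L by auto
  ultimately obtain c where c: "0 \<le> c" "c \<le> 1" "?N c = 0"
    using IVT2'[of ?N 1 0 0] by auto
  have c0: "c \<noteq> 0" "c \<noteq> 1" using c(3) L by auto
  have pos: "(1 + r) * (1 + r\<^sup>2) > 0" if "r \<ge> 0" for r :: real
    using that by (intro mult_pos_pos) (auto simp: add_pos_nonneg)
  have inc: "rho_gap L x < rho_gap L y" if "0 \<le> x" "x < y" "y \<le> c" for x y
  proof (rule DERIV_pos_imp_increasing_open[OF that(2)])
    show "\<exists>d. (rho_gap L has_real_derivative d) (at r) \<and> d > 0" if r: "x < r" "r < y" for r
    proof -
      have "?N r > 0" using Nmono[of r c] r that c \<open>0 \<le> x\<close> \<open>y \<le> c\<close> by simp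
      then have "?N r / ((1 + r) * (1 + r\<^sup>2)) > 0" using pos[of r] r \<open>0 \<le> x\<close> by simp
      then show ?thesis using rho_gap_deriv[of r L] r \<open>0 \<le> x\<close> by (intro exI conjI) auto
    qed
    show "continuous_on {x..y} (rho_gap L)" using that by (intro cont) simp
  qed
  have dec: "rho_gap L y < rho_gap L x" if "c \<le> x" "x < y" for x y
  proof (rule DERIV_neg_imp_decreasing_open[OF that(2)])
    show "\<exists>d. (rho_gap L has_real_derivative d) (at r) \<and> d < 0" if r: "x < r" "r < y" for r
    proof -
      have "?N r < 0" using Nmono[of c r] r c \<open>c \<le> x\<close> by simp
      then have "?N r / ((1 + r) * (1 + r\<^sup>2)) < 0"
        using pos[of r] r \<open>c \<le> x\<close> c by (intro divide_neg_pos) auto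
      then show ?thesis using rho_gap_deriv[of r L] r \<open>c \<le> x\<close> c by (intro exI conjI) auto
    qed
    show "continuous_on {x..y} (rho_gap L)" using that c by (intro cont) simp
  qed
  have g0: "rho_gap L 0 < 0" and g1: "rho_gap L 1 = 0"
    by (simp_all add: rho_gap_def algebra_simps)
  have gc: "rho_gap L c > 0" using dec[of c 1] c c0 g1 by simp
  then obtain s where s: "0 \<le> s" "s \<le> c" "rho_gap L s = 0"
    using IVT'[of "rho_gap L" 0 0 c] g0 cont[of 0 c] c by auto
  have s0: "s \<noteq> 0" "s \<noteq> c" using s g0 gc by auto
  show thesis
  proof
    show "0 < s" "s < 1" using s s0 c c0 by auto
    show "rho_gap L r < 0" if "0 < r" "r < s" for r using inc[of r s] s that by simp
    show "rho_gap L r > 0" if "s < r" "r < 1" for r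
      using inc[of s r] dec[of r 1] s that g1 by (cases "r \<le> c") auto
  qed (use s in auto)
qed

lemma rho_star_props:
  assumes "L \<ge> 3"
  shows "0 < rho_star L" "rho_star L < 1" "rho_gap L (rho_star L) = 0"
    and "\<And>r. 0 < r \<Longrightarrow> r < rho_star L \<Longrightarrow> rho_gap L r < 0"
    and "\<And>r. rho_star L < r \<Longrightarrow> r < 1 \<Longrightarrow> rho_gap L r > 0"
proof -
  obtain s where s: "0 < s" "s < 1" "rho_gap L s = 0"
    "\<And>r. 0 < r \<Longrightarrow> r < s \<Longrightarrow> rho_gap L r < 0" "\<And>r. s < r \<Longrightarrow> r < 1 \<Longrightarrow> rho_gap L r > 0"
    using rho_gap_shape[OF assms] by blast
  have "(THE r. 0 < r \<and> r < 1 \<and> (1 + r) ^ L = 2 * (1 + r\<^sup>2) ^ (L - 1)) = s"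
  proof (rule the_equality)
    show "0 < s \<and> s < 1 \<and> (1 + s) ^ L = 2 * (1 + s\<^sup>2) ^ (L - 1)"
      using s rho_gap_sign(1)[of L s] assms by simp
    fix r :: real assume r: "0 < r \<and> r < 1 \<and> (1 + r) ^ L = 2 * (1 + r\<^sup>2) ^ (L - 1)"
    then have "rho_gap L r = 0" using rho_gap_sign(1)[of L r] assms by simp
    then show "r = s" using s(4,5)[of r] r by linarith
  qed
  then have "rho_star L = s" using assms by (simp add: rho_star_def)
  with s show "0 < rho_star L" "rho_star L < 1" "rho_gap L (rho_star L) = 0"
    "\<And>r. 0 < r \<Longrightarrow> r < rho_star L \<Longrightarrow> rho_gap L r < 0"
    "\<And>r. rho_star L < r \<Longrightarrow> r < 1 \<Longrightarrow> rho_gap L r > 0" by auto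
qed

text \<open>Insert the Taylor bounds and the value of \<open>L * r\<close>. The constant term
  \<open>ln 2\<close> cancels, and the linear coefficient is \<open>3/2 - 1/2 - 1 = 0\<close> times
  \<open>ln 2\<close>: this is the origin of the constant 3/2. At order \<open>r^2\<close> there
  remains \<open>1 - 23/12 * ln 2 < 0\<close>.\<close>

lemma rho_gap_neg:
  assumes "0 < r" "r < 5/12" "real L * r = ln 2 + 3/2 * ln 2 * r"
  shows "rho_gap L r < 0"
proof -
  define a :: real where "a = ln 2"
  have a: "a \<ge> 2/3" unfolding a_def by (rule ln2_ge_two_thirds)
  have L1: "real L \<ge> 1"
  proof (rule ccontr)
    assume "\<not> real L \<ge> 1"
    then have "L = 0" by linarith
    have "3/2 * a * r > 0" using assms a by simp
    moreover have "0 = a + 3/2 * a * r" using assms(3) \<open>L = 0\<close> by (simp add: a_def)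
    ultimately show False using a by linarith
  qed
  have "real L * ln (1 + r) \<le> real L * (r - r\<^sup>2 / 2 + r ^ 3 / 3)"
    using ln_one_plus_le_cubic[of r] assms by (intro mult_left_mono) auto
  moreover have "(real L - 1) * (r\<^sup>2 - (r\<^sup>2)\<^sup>2 / 2) \<le> (real L - 1) * ln (1 + r\<^sup>2)"
    using ln_one_plus_ge_quadratic[of "r\<^sup>2"] L1 by (intro mult_left_mono) auto
  ultimately have "rho_gap L r \<le> real L * (r - r\<^sup>2 / 2 + r ^ 3 / 3) - (real L - 1) * (r\<^sup>2 - (r\<^sup>2)\<^sup>2 / 2) - a"
    unfolding rho_gap_def a_def by (simp only: diff_mono diff_right_mono)
  also have "\<dots> = (real L * r) * (1 - r / 2 + r\<^sup>2 / 3) - (real L * r - r) * (r - r ^ 3 / 2) - a"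
    by (simp add: algebra_simps power2_eq_square power3_eq_cube)
  also have "\<dots> = r\<^sup>2 * (a * (-23/12 + r + 3/4 * r\<^sup>2) + 1 - r\<^sup>2 / 2)"
    unfolding assms(3) a_def[symmetric]
    by (simp add: field_simps power2_eq_square power3_eq_cube)
  also have "\<dots> < 0"
  proof -
    have "r\<^sup>2 \<le> r * 1" using assms unfolding power2_eq_square by (intro mult_left_mono) auto
    then have "-23/12 + r + 3/4 * r\<^sup>2 \<le> 0" using assms by linarith
    \<comment> \<open>Replacing \<open>a\<close> by 2/3 makes the \<open>r^2\<close> terms cancel
      and leaves \<open>2/3 * r - 5/18\<close>, which is negative for
      \<open>r < 5/12\<close>.\<close>
    then have "a * (-23/12 + r + 3/4 * r\<^sup>2) \<le> 2/3 * (-23/12 + r + 3/4 * r\<^sup>2)"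
      using a by (intro mult_right_mono_neg)
    then have "a * (-23/12 + r + 3/4 * r\<^sup>2) + 1 - r\<^sup>2 / 2 < 0" using assms(2) by (simp add: algebra_simps)
    then show ?thesis using assms(1) by (simp add: mult_pos_neg)
  qed
  finally show ?thesis .
qed

text \<open>The gap is zero at \<open>rho_star L\<close> and positive between it and 1, so a point
  below 1 with negative gap lies to the left of \<open>rho_star L\<close>.\<close>

lemma rho_star_lower_bound:
  assumes "L \<ge> 2"
  shows "rho_star L > ln 2 / (real L - 3 / 2 * ln 2)"
proof (cases "L = 2")
  case True
  have "ln 2 \<le> (25/36 :: real)" by (rule ln2_le_25_over_36)
  then show ?thesis using True by (simp add: rho_star_def divide_simps)
next
  case False
  then have L: "L \<ge> 3" using assms by simp
  have a: "ln 2 \<le> (25/36 :: real)" "ln 2 > (0::real)" using ln2_le_25_over_36 by auto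
  define r where "r = ln 2 / (real L - 3 / 2 * ln 2)"
  \<comment> \<open>\<open>47/24 = 3 - 3/2 * 25/36\<close>, from \<open>L \<ge> 3\<close> and the
    upper bound on \<open>ln 2\<close>. It yields \<open>r \<le> 50/141\<close>, below the threshold
    5/12.\<close>
  have d: "real L - 3/2 * ln 2 \<ge> 47/24" using a L by simp
  then have r: "0 < r" using a unfolding r_def by simp
  have "r \<le> (25/36) / (47/24)" unfolding r_def using a d by (intro frac_le) auto
  then have r2: "r < 5/12" by simp
  have "r * (real L - 3/2 * ln 2) = ln 2" using d by (simp add: r_def)
  then have "real L * r = ln 2 + 3/2 * ln 2 * r" by (simp add: algebra_simps)
  then have "rho_gap L r < 0" using rho_gap_neg r r2 by blast
  then have "r < rho_star L"
    using rho_star_props(3)[OF L] rho_star_props(5)[OF L, of r] r2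
    by (cases r "rho_star L" rule: linorder_cases) auto
  then show ?thesis by (simp add: r_def)
qed

text \<open>For \<open>L = 2\<close> the power inequality is \<open>(1 - r)^2 \<ge> 0\<close>, and
  strictness gives \<open>r < 1\<close>. For larger \<open>L\<close> it is the sign of the gap up to
  its interior zero.\<close>

lemma rho_le_rho_star:
  assumes "L \<ge> 2" "0 < r" "r \<le> rho_star L" "L = 2 \<longrightarrow> r < rho_star L"
  shows "r < 1" "(1 + r) ^ L \<le> 2 * (1 + r\<^sup>2) ^ (L - 1)"
proof -
  have "r < 1 \<and> (1 + r) ^ L \<le> 2 * (1 + r\<^sup>2) ^ (L - 1)"
  proof (cases "L = 2")
    case True
    have "0 \<le> (1 - r)\<^sup>2" by simp
    then have "(1 + r)\<^sup>2 \<le> 2 * (1 + r\<^sup>2)" by (simp add: power2_eq_square algebra_simps)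
    then show ?thesis using True assms by (simp add: rho_star_def)
  next
    case False
    then have L: "L \<ge> 3" using assms by simp
    have "rho_gap L r \<le> 0" using rho_star_props(3,4)[OF L] assms by (cases "r = rho_star L") force+
    then show ?thesis using rho_gap_sign(2)[of L r] rho_star_props(2)[OF L] assms by simp
  qed
  then show "r < 1" "(1 + r) ^ L \<le> 2 * (1 + r\<^sup>2) ^ (L - 1)" by auto
qed

text \<open>Parallel connection multiplies \<open>1 + v\<close>, and
  \<open>1 + v = (1 + (q - 1) * t) / (1 - t)\<close>. At the extremal point
  \<open>q - 1 = -1/\<rho>\<close>, \<open>t = -r\<close> this is
  \<open>(1 + r/\<rho>) / (1 + r)\<close>; equating it with \<open>X^k\<close> and solving for
  \<open>r\<close> gives the formula.\<close>

definition flow_radius :: "real \<Rightarrow> real \<Rightarrow> nat \<Rightarrow> real" where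
  "flow_radius \<rho> X k = \<rho> * (X ^ k - 1) / (1 - \<rho> * X ^ k)"

lemma flow_radius_le:
  assumes "0 < \<rho>" "\<rho> < 1" "1 \<le> X" "k \<le> l" "\<rho> * X ^ l < 1"
  shows "flow_radius \<rho> X k \<le> flow_radius \<rho> X l"
proof -
  have xy: "X ^ k \<le> X ^ l" using assms by (intro power_increasing)
  then have "\<rho> * X ^ k \<le> \<rho> * X ^ l" using assms by simp
  then have k: "\<rho> * X ^ k < 1" using assms by linarith
  \<comment> \<open>This product is the difference of the two sides after cross-multiplication:
    \<open>1 - \<rho>\<close> is the determinant of the Moebius map
    \<open>x \<mapsto> (x - 1) / (1 - \<rho> * x)\<close>.\<close>
  have "(X ^ k - X ^ l) * (1 - \<rho>) \<le> 0" using xy assms by (intro mult_nonpos_nonneg) auto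
  then have "(X ^ k - 1) * (1 - \<rho> * X ^ l) \<le> (X ^ l - 1) * (1 - \<rho> * X ^ k)"
    by (simp add: algebra_simps)
  then have "(X ^ k - 1) / (1 - \<rho> * X ^ k) \<le> (X ^ l - 1) / (1 - \<rho> * X ^ l)"
    using k assms by (simp add: pos_le_divide_eq pos_divide_le_eq)
  then have "\<rho> * ((X ^ k - 1) / (1 - \<rho> * X ^ k)) \<le> \<rho> * ((X ^ l - 1) / (1 - \<rho> * X ^ l))"
    using assms by (intro mult_left_mono) auto
  then show ?thesis by (simp add: flow_radius_def)
qed

text \<open>An equality, because the triangle inequalities used for parallel connection are sharp at
  \<open>q - 1 = -1/\<rho>\<close> and negative \<open>t\<close>; there it expresses
  \<open>X^k * X^l = X^(k+l)\<close> as the product rule for \<open>1 + v\<close>.\<close>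

lemma flow_radius_add:
  assumes "0 < \<rho>" "\<rho> < 1" "\<rho> * X ^ k < 1" "\<rho> * X ^ l < 1" "\<rho> * X ^ (k + l) < 1"
  shows "flow_radius \<rho> X k + flow_radius \<rho> X l + (1 / \<rho> + 1) * flow_radius \<rho> X k * flow_radius \<rho> X l
    = flow_radius \<rho> X (k + l) * (1 - 1 / \<rho> * flow_radius \<rho> X k * flow_radius \<rho> X l)"
proof -
  define x y where "x = X ^ k" and "y = X ^ l"
  define a b c where "a = 1 - \<rho> * x" and "b = 1 - \<rho> * y" and "c = 1 - \<rho> * (x * y)"
  have nz: "a \<noteq> 0" "b \<noteq> 0" "c \<noteq> 0" "\<rho> \<noteq> 0"
    using assms by (auto simp: a_def b_def c_def x_def y_def power_add)
  have r: "flow_radius \<rho> X k = \<rho> * (x - 1) / a" "flow_radius \<rho> X l = \<rho> * (y - 1) / b"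
    "flow_radius \<rho> X (k + l) = \<rho> * (x * y - 1) / c"
    by (simp_all add: flow_radius_def x_def y_def a_def b_def c_def power_add)
  have "\<rho> * (x - 1) / a + \<rho> * (y - 1) / b + (1 / \<rho> + 1) * (\<rho> * (x - 1) / a) * (\<rho> * (y - 1) / b)
    = \<rho> * ((x - 1) * b + (y - 1) * a + (1 + \<rho>) * (x - 1) * (y - 1)) / (a * b)"
    using nz by (simp add: field_simps)
  also have "(x - 1) * b + (y - 1) * a + (1 + \<rho>) * (x - 1) * (y - 1) = (1 - \<rho>) * (x * y - 1)"
    by (simp add: a_def b_def algebra_simps)
  also have "\<rho> * ((1 - \<rho>) * (x * y - 1)) / (a * b) = \<rho> * (x * y - 1) / c * ((1 - \<rho>) * c / (a * b))"
    using nz by simp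
  also have "(1 - \<rho>) * c = a * b - \<rho> * (x - 1) * (y - 1)"
    by (simp add: a_def b_def c_def algebra_simps)
  also have "(a * b - \<rho> * (x - 1) * (y - 1)) / (a * b) = 1 - 1 / \<rho> * (\<rho> * (x - 1) / a) * (\<rho> * (y - 1) / b)"
    using nz by (simp add: field_simps)
  finally show ?thesis unfolding r .
qed

text \<open>This determines \<open>X\<close>: radius \<open>\<rho>\<close> means
  \<open>x - 1 = 1 - \<rho> * x\<close> for \<open>x = X^n\<close>, that is
  \<open>x = 2 / (1 + \<rho>)\<close>.\<close>

lemma flow_radius_top:
  assumes "0 < \<rho>" "\<rho> < 1" "X ^ n = 2 / (1 + \<rho>)"
  shows "flow_radius \<rho> X n = \<rho>"
proof -
  have "X ^ n - 1 = (1 - \<rho>) / (1 + \<rho>)" "1 - \<rho> * X ^ n = (1 - \<rho>) / (1 + \<rho>)"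
    using assms by (simp_all add: field_simps)
  then show ?thesis using assms by (simp add: flow_radius_def)
qed

text \<open>Clearing the denominator turns the claim into
  \<open>1 + \<rho> \<le> X * (1 + \<rho>^2)\<close>. Its \<open>n\<close>-th power, with
  \<open>X^n = 2 / (1 + \<rho>)\<close>, is the assumed power inequality.\<close>

lemma flow_radius_one:
  assumes "0 < \<rho>" "\<rho> < 1" "1 \<le> X" "X ^ n = 2 / (1 + \<rho>)" "(1 + \<rho>) ^ Suc n \<le> 2 * (1 + \<rho>\<^sup>2) ^ n"
    "\<rho> * X < 1" "n \<ge> 1"
  shows "\<rho>\<^sup>2 \<le> flow_radius \<rho> X 1"
proof -
  have "(1 + \<rho>) * (1 + \<rho>) ^ n \<le> 2 * (1 + \<rho>\<^sup>2) ^ n" using assms(5) by simp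
  then have "(1 + \<rho>) ^ n \<le> (X * (1 + \<rho>\<^sup>2)) ^ n"
    using assms(1) unfolding power_mult_distrib assms(4) by (simp add: pos_le_divide_eq mult.commute)
  then have "1 + \<rho> \<le> X * (1 + \<rho>\<^sup>2)"
    using power_mono_iff[of "1 + \<rho>" "X * (1 + \<rho>\<^sup>2)" n] assms by simp
  then have "\<rho> * (1 - \<rho> * X) \<le> X - 1" by (simp add: algebra_simps power2_eq_square)
  then have "\<rho> * (\<rho> * (1 - \<rho> * X)) \<le> \<rho> * (X - 1)" using assms by (intro mult_left_mono) auto
  then have "\<rho>\<^sup>2 * (1 - \<rho> * X) \<le> \<rho> * (X - 1)" by (simp add: power2_eq_square mult.assoc)
  then show ?thesis using assms by (simp add: flow_radius_def pos_le_divide_eq)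
qed

section \<open>Capacities under series-parallel reduction\<close>

text \<open>\<open>S\<close> ranges over all vertex sets, not only subsets of \<open>V\<close>, so a
  witness needs no adjustment when a subdivision vertex is removed.\<close>

definition cut_bounded :: "'v set \<Rightarrow> 'e set \<Rightarrow> ('e \<Rightarrow> 'v set) \<Rightarrow> ('e \<Rightarrow> nat) \<Rightarrow> nat \<Rightarrow> bool" where
  "cut_bounded V E ends c L \<longleftrightarrow>
    (\<forall>x\<in>V. \<forall>y\<in>V. x \<noteq> y \<longrightarrow> (\<exists>S. x \<in> S \<and> y \<notin> S \<and> sum c (cut E ends S) \<le> L))"

lemma cut_bounded_transfer:
  assumes "cut_bounded V' E' ends' c' L" "V \<subseteq> V'"
    and "\<And>S. sum c (cut E ends S) \<le> sum c' (cut E' ends' S)"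
  shows "cut_bounded V E ends c L"
  unfolding cut_bounded_def
proof (intro ballI impI)
  fix x y assume "x \<in> V" "y \<in> V" "x \<noteq> y"
  with assms(2) have "x \<in> V'" "y \<in> V'" by auto
  with \<open>x \<noteq> y\<close> obtain S where S: "x \<in> S" "y \<notin> S" "sum c' (cut E' ends' S) \<le> L"
    using assms(1)[unfolded cut_bounded_def, rule_format, of x y] by blast
  from order_trans[OF assms(3) S(3)] S(1,2)
  show "\<exists>S. x \<in> S \<and> y \<notin> S \<and> sum c (cut E ends S) \<le> L" by blast
qed

text \<open>A cut separating the ends of a non-bridge contains a further edge, of capacity at least 1.\<close>

lemma nonbridge_capacity:
  assumes "finite E" "cut_bounded V E ends c (Suc n)" "\<And>e. e \<in> E \<Longrightarrow> 1 \<le> c e"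
    "e \<in> E" "ends e = {a, b}" "a \<in> V" "b \<in> V" "a \<noteq> b" "\<not> bridge E ends e"
  shows "c e \<le> n"
proof -
  obtain S where S: "a \<in> S" "b \<notin> S" "sum c (cut E ends S) \<le> Suc n"
    using assms(2,6-8) unfolding cut_bounded_def by blast
  have e: "e \<in> cut E ends S" using S assms(4,5) by (auto simp: cut_def)
  moreover have "cut E ends S \<noteq> {e}" using assms(9) by (auto simp: bridge_def)
  ultimately obtain e' where e': "e' \<in> cut E ends S" "e' \<noteq> e" by blast
  have "c e + 1 \<le> c e + c e'" using assms(3)[of e'] e' cut_subset[of E ends S] by auto
  also have "\<dots> = sum c {e, e'}" using e' by simp
  also have "\<dots> \<le> sum c (cut E ends S)"
    using e e' assms(1) finite_subset[OF cut_subset] by (intro sum_mono2) auto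
  finally show ?thesis using S(3) by simp
qed

section \<open>Cuts and bridges under a single series or parallel step\<close>

locale series_extension =
  fixes E :: "'e set" and ends :: "'e \<Rightarrow> 'v set" and e e1 e2 :: 'e and a b w :: 'v
  assumes finE: "finite E" and e: "e \<notin> E" "ends e = {a, b}" and w: "w \<noteq> a" "w \<noteq> b"
    and new: "e1 \<noteq> e2" "e1 \<notin> E" "e2 \<notin> E"
begin

text \<open>\<open>insert e E\<close> is the reduced and \<open>E'\<close> the extended edge set.
  The label \<open>e\<close> may be reused as \<open>e1\<close> or \<open>e2\<close>, which is why
  the common part \<open>E\<close> is kept free of all three.\<close>

definition ends' where "ends' = ends(e1 := {a, w}, e2 := {w, b})"
definition E' where "E' = insert e1 (insert e2 E)"

lemma cut_crossing:
  assumes "e \<in> cut (insert e E) ends S"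
  shows "e1 \<in> cut E' ends' S \<or> e2 \<in> cut E' ends' S"
  using assms e new by (auto simp: cut_def ends'_def E'_def)

lemma cut_mem_old: "f \<in> E \<Longrightarrow> f \<in> cut E' ends' S \<longleftrightarrow> f \<in> cut (insert e E) ends S"
  using new by (auto simp: cut_def ends'_def E'_def)

text \<open>If \<open>S\<close> separates \<open>a\<close> from \<open>b\<close>, then on whichever
  side \<open>w\<close> lies one of \<open>e1\<close>, \<open>e2\<close> crosses, and the minimum of
  the capacities is at most what that edge pays.\<close>

lemma sum_cut_le:
  "sum (c(e := min (c e1) (c e2))) (cut (insert e E) ends S) \<le> sum (c :: 'e \<Rightarrow> nat) (cut E' ends' S)"
proof -
  have fin: "finite (cut E ends S)" "finite (cut E' ends' S)"
    using finE by (auto intro: finite_subset[OF cut_subset] simp: E'_def)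
  have sub: "cut E ends S \<subseteq> cut E' ends' S" using new by (auto simp: cut_def ends'_def E'_def)
  have nin: "e \<notin> cut E ends S" "e1 \<notin> cut E ends S" "e2 \<notin> cut E ends S"
    using cut_subset[of E ends S] e new by auto
  have s: "sum (c(e := min (c e1) (c e2))) (cut E ends S) = sum c (cut E ends S)"
    using nin by (intro sum.cong) auto
  show ?thesis
  proof (cases "e \<in> cut (insert e E) ends S")
    case True
    then obtain f where f: "f = e1 \<or> f = e2" "f \<in> cut E' ends' S" using cut_crossing by blast
    have "cut (insert e E) ends S = insert e (cut E ends S)"
      using True by (auto simp: cut_def)
    then have "sum (c(e := min (c e1) (c e2))) (cut (insert e E) ends S) = min (c e1) (c e2) + sum c (cut E ends S)"
      using fin nin s by simp
    also have "\<dots> \<le> c f + sum c (cut E ends S)" using f by auto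
    also have "\<dots> = sum c (insert f (cut E ends S))" using f nin fin by auto
    also have "\<dots> \<le> sum c (cut E' ends' S)" using f sub fin by (intro sum_mono2) auto
    finally show ?thesis .
  next
    case False
    then have "cut (insert e E) ends S = cut E ends S" by (auto simp: cut_def)
    then show ?thesis using s sub fin by (simp add: sum_mono2)
  qed
qed

text \<open>If just one of \<open>e1\<close>, \<open>e2\<close> crosses \<open>S\<close>, then
  \<open>S\<close> separates \<open>a\<close> from \<open>b\<close> and \<open>e\<close> crosses as
  well. The direction matters: an edge that is not a bridge after the reduction must come from edges
  whose weights were under control.\<close>

lemma bridge_new: "f = e1 \<or> f = e2 \<Longrightarrow> bridge E' ends' f \<Longrightarrow> bridge (insert e E) ends e"
proof -
  assume f: "f = e1 \<or> f = e2" and "bridge E' ends' f"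
  then obtain S where S: "cut E' ends' S = {f}" by (auto simp: bridge_def)
  then have "e1 \<notin> cut E' ends' S \<or> e2 \<notin> cut E' ends' S" "f \<in> cut E' ends' S" using new by auto
  then have "e \<in> cut (insert e E) ends S" using f e new by (auto simp: cut_def ends'_def E'_def)
  moreover have "g \<notin> cut (insert e E) ends S" if "g \<in> E" for g
    using cut_mem_old[OF that, of S] S that f new by auto
  ultimately have "cut (insert e E) ends S = {e}" using cut_subset[of "insert e E" ends S] by auto
  then show ?thesis by (auto simp: bridge_def)
qed

lemma bridge_old: "f \<in> E \<Longrightarrow> bridge E' ends' f \<Longrightarrow> bridge (insert e E) ends f"
proof -
  assume f: "f \<in> E" and "bridge E' ends' f"
  then obtain S where S: "cut E' ends' S = {f}" by (auto simp: bridge_def)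
  then have "e \<notin> cut (insert e E) ends S" using cut_crossing[of S] f new by auto
  moreover have "g \<in> cut (insert e E) ends S \<longleftrightarrow> g = f" if "g \<in> E" for g
    using cut_mem_old[OF that, of S] S by auto
  ultimately have "cut (insert e E) ends S = {f}" using cut_subset[of "insert e E" ends S] f by auto
  then show ?thesis by (auto simp: bridge_def)
qed

end

locale parallel_extension =
  fixes E :: "'e set" and ends :: "'e \<Rightarrow> 'v set" and e e1 e2 :: 'e
  assumes finE: "finite E" and e: "e \<notin> E" and new: "e1 \<noteq> e2" "e1 \<notin> E" "e2 \<notin> E"
begin

definition ends' where "ends' = ends(e1 := ends e, e2 := ends e)"
definition E' where "E' = insert e1 (insert e2 E)"

lemma cut_E':
  "cut E' ends' S =
    (if e \<in> cut (insert e E) ends S then insert e1 (insert e2 (cut E ends S)) else cut E ends S)"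
  using e new by (auto simp: cut_def ends'_def E'_def)

lemma cut_E:
  "cut (insert e E) ends S =
    (if e \<in> cut (insert e E) ends S then insert e (cut E ends S) else cut E ends S)"
  by (auto simp: cut_def)

lemma sum_cut_le:
  "sum (c(e := c e1 + c e2)) (cut (insert e E) ends S) \<le> sum (c :: 'e \<Rightarrow> nat) (cut E' ends' S)"
proof -
  have fin: "finite (cut E ends S)" using finE by (auto intro: finite_subset[OF cut_subset])
  have nin: "e \<notin> cut E ends S" "e1 \<notin> cut E ends S" "e2 \<notin> cut E ends S"
    using cut_subset[of E ends S] e new by auto
  have s: "sum (c(e := c e1 + c e2)) (cut E ends S) = sum c (cut E ends S)"
    using nin by (intro sum.cong) auto
  show ?thesis
    by (subst cut_E, subst cut_E') (use fin nin s new in auto)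
qed

text \<open>Parallel edges lie in the same cuts, so neither is ever alone in one; the weights of
  both are therefore known to be admissible.\<close>

lemma bridge_new: "\<not> bridge E' ends' e1" "\<not> bridge E' ends' e2"
proof -
  have "e1 \<in> cut E' ends' S \<longleftrightarrow> e2 \<in> cut E' ends' S" for S
    using new by (auto simp: cut_def ends'_def E'_def)
  then show "\<not> bridge E' ends' e1" "\<not> bridge E' ends' e2"
    unfolding bridge_def using new(1) by (metis insertI1 singletonD)+
qed

lemma bridge_old: "f \<in> E \<Longrightarrow> bridge E' ends' f \<Longrightarrow> bridge (insert e E) ends f"
proof -
  assume f: "f \<in> E" and "bridge E' ends' f"
  then obtain S where S: "cut E' ends' S = {f}" by (auto simp: bridge_def)
  then have "e \<notin> cut (insert e E) ends S" using f new by (auto simp: cut_E' split: if_splits)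
  then have "cut (insert e E) ends S = {f}" using S cut_E'[of S] cut_E[of S] by simp
  then show ?thesis by (auto simp: bridge_def)
qed

end

text \<open>What the induction uses about the radii, with \<open>n\<close> for
  \<open>\<Lambda> - 1\<close>: \<open>r_one\<close> serves series connection, \<open>r_add\<close>
  parallel connection, and \<open>r_top\<close> keeps all radii at most
  \<open>1 / cmod (q - 1)\<close>, the modulus belonging to \<open>v = -1\<close>.\<close>

locale flow_radii =
  fixes q :: complex and n :: nat and r :: "nat \<Rightarrow> real"
  assumes q: "cmod (q - 1) > 1" and n1: "1 \<le> n"
    and r_mono: "\<And>k l. \<lbrakk>1 \<le> k; k \<le> l; l \<le> n\<rbrakk> \<Longrightarrow> r k \<le> r l"
    and r_one: "(1 / cmod (q - 1))\<^sup>2 \<le> r 1"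
    and r_top: "r n \<le> 1 / cmod (q - 1)"
    and r_add: "\<And>k l. \<lbrakk>1 \<le> k; 1 \<le> l; k + l \<le> n\<rbrakk> \<Longrightarrow>
      r k + r l + (cmod (q - 1) + 1) * r k * r l \<le> r (k + l) * (1 - cmod (q - 1) * r k * r l)"
begin

text \<open>The value \<open>-1 / (q - 1)\<close> is the transmissivity of an edge with \<open>v = -1\<close>; it is absorbing
  for parallel connection.\<close>

definition admissible :: "nat \<Rightarrow> complex \<Rightarrow> bool" where
  "admissible k t \<longleftrightarrow> t = -1 / (q - 1) \<or> k \<le> n \<and> cmod t \<le> r k"

lemma q0: "q \<noteq> 0" and q1: "q - 1 \<noteq> 0"
  using q by auto

lemma r_pos: "1 \<le> k \<Longrightarrow> k \<le> n \<Longrightarrow> 0 \<le> r k"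
  using r_mono[of 1 k] r_one zero_le_power2[of "1 / cmod (q - 1)"] by linarith

lemma r_le: "1 \<le> k \<Longrightarrow> k \<le> n \<Longrightarrow> r k \<le> 1 / cmod (q - 1)"
  using r_mono[of k n] r_top by linarith

lemma admissible_le: "admissible k t \<Longrightarrow> 1 \<le> k \<Longrightarrow> cmod t \<le> 1 / cmod (q - 1)"
  using r_le[of k] by (auto simp: admissible_def norm_divide)

lemma admissible_mult_le:
  assumes "admissible k s" "admissible l t" "1 \<le> k" "1 \<le> l"
  shows "cmod (s * t) \<le> (1 / cmod (q - 1))\<^sup>2"
  unfolding norm_mult power2_eq_square
  using admissible_le[OF assms(1,3)] admissible_le[OF assms(2,4)] by (intro mult_mono) auto

lemma admissible_series:
  assumes "admissible k s" "admissible l t" "1 \<le> k" "1 \<le> l" "min k l \<le> n"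
  shows "admissible (min k l) (s * t)"
  using admissible_mult_le[OF assms(1-4)] r_one r_mono[of 1 "min k l"] assms(3-5)
  unfolding admissible_def by force

text \<open>Both moduli are at most \<open>1 / cmod (q - 1)\<close>, so
  \<open>(q - 1) * (s * t)\<close> has modulus below 1. No bound on \<open>k + l\<close> enters, so
  the case in which the merged edge becomes a bridge of capacity above \<open>n\<close> is
  covered.\<close>

lemma parallel_nonzero:
  assumes "admissible k s" "admissible l t" "1 \<le> k" "1 \<le> l"
  shows "1 + (q - 1) * (s * t) \<noteq> 0"
proof
  assume "1 + (q - 1) * (s * t) = 0"
  then have "(q - 1) * (s * t) = -1" by (simp add: add_eq_0_iff)
  then have "cmod ((q - 1) * (s * t)) = 1" by simp
  moreover have "cmod ((q - 1) * (s * t)) \<le> cmod (q - 1) * (1 / cmod (q - 1))\<^sup>2"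
    unfolding norm_mult[of "q - 1"] using admissible_mult_le[OF assms] by (intro mult_left_mono) auto
  moreover have "cmod (q - 1) * (1 / cmod (q - 1))\<^sup>2 = 1 / cmod (q - 1)"
    using q by (simp add: power2_eq_square)
  moreover have "1 / cmod (q - 1) < 1" using q by (subst divide_less_eq_1_pos) linarith+
  ultimately show False by linarith
qed

text \<open>The triangle inequality is applied to numerator and denominator separately; the two
  estimates are the two sides of \<open>r_add\<close>.\<close>

lemma admissible_parallel:
  assumes "admissible k s" "admissible l t" "1 \<le> k" "1 \<le> l" "k + l \<le> n"
  shows "admissible (k + l) ((s + t + (q - 2) * (s * t)) / (1 + (q - 1) * (s * t)))"
proof -
  note nz = parallel_nonzero[OF assms(1-4)]
  \<comment> \<open>If \<open>(q - 1) * x = -1\<close>, the numerator times \<open>q - 1\<close> is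
    minus the denominator. In terms of \<open>v\<close> this says that a factor
    \<open>1 + v = 0\<close> annihilates the product.\<close>
  have absorb: "(x + y + (q - 2) * (x * y)) / (1 + (q - 1) * (x * y)) = -1 / (q - 1)"
    if "1 + (q - 1) * (x * y) \<noteq> 0" "x = -1 / (q - 1)" for x y
  proof -
    have x: "(q - 1) * x = -1" using that(2) q1 by simp
    have "(q - 1) * (x + y + (q - 2) * (x * y)) = (q - 1) * x + (q - 1) * y + (q - 2) * ((q - 1) * x) * y"
      by (simp add: algebra_simps)
    also have "\<dots> = - (1 + ((q - 1) * x) * y)" unfolding x by (simp add: algebra_simps)
    finally have "(x + y + (q - 2) * (x * y)) * (q - 1) = -1 * (1 + (q - 1) * (x * y))"
      by (simp add: mult.assoc mult.commute)
    then show ?thesis by (simp only: frac_eq_eq[OF that(1) q1])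
  qed
  show ?thesis
  proof (cases "s = -1 / (q - 1) \<or> t = -1 / (q - 1)")
    case True
    then show ?thesis
      using absorb[of s t] absorb[of t s] nz unfolding admissible_def
      by (auto simp: mult.commute add.commute)
  next
    case False
    then have st: "cmod s \<le> r k" "cmod t \<le> r l" using assms(1,2) by (auto simp: admissible_def)
    have rk: "0 \<le> r k" "0 \<le> r l" "0 \<le> r (k + l)" using assms by (auto intro: r_pos)
    have m: "cmod (s * t) \<le> r k * r l" unfolding norm_mult using st rk by (intro mult_mono) auto
    have "cmod (q - 2) \<le> cmod (q - 1) + 1" using norm_triangle_ineq4[of "q - 1" 1] by simp
    then have "cmod ((q - 2) * (s * t)) \<le> (cmod (q - 1) + 1) * (r k * r l)"
      unfolding norm_mult[of "q - 2"] using m by (intro mult_mono) auto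
    then have "cmod (s + t + (q - 2) * (s * t)) \<le> r k + r l + (cmod (q - 1) + 1) * r k * r l"
      using st norm_triangle_ineq[of "s + t" "(q - 2) * (s * t)"] norm_triangle_ineq[of s t]
      by (simp add: mult.assoc)
    also have "\<dots> \<le> r (k + l) * (1 - cmod (q - 1) * r k * r l)" using r_add assms(3-5) by blast
    also have "\<dots> \<le> r (k + l) * cmod (1 + (q - 1) * (s * t))"
    proof (rule mult_left_mono[OF _ rk(3)])
      have "cmod ((q - 1) * (s * t)) \<le> cmod (q - 1) * (r k * r l)"
        unfolding norm_mult[of "q - 1"] using m by (intro mult_left_mono) auto
      then show "1 - cmod (q - 1) * r k * r l \<le> cmod (1 + (q - 1) * (s * t))"
        using norm_diff_ineq[of 1 "(q - 1) * (s * t)"] by (simp add: mult.assoc)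
    qed
    finally show ?thesis
      using nz assms(5) by (simp add: admissible_def norm_divide pos_divide_le_eq)
  qed
qed

text \<open>Each case of the induction undoes the outermost operation. \<open>c\<close> and
  \<open>t\<close> are quantified in the conclusion because every reduction replaces them;
  well-formedness and looplessness are proved along, since \<open>sp_ind\<close> asserts them only
  for the initial forest.\<close>

lemma transZ_nonzero:
  assumes "sp_ind V E ends"
  shows "wf_graph V E ends \<and> loopless E ends \<and>
    (\<forall>c t. (\<forall>e\<in>E. 1 \<le> c e) \<longrightarrow> cut_bounded V E ends c (Suc n) \<longrightarrow>
      (\<forall>e\<in>E. bridge E ends e \<or> admissible (c e) (t e)) \<longrightarrow> transZ V E ends q t \<noteq> 0)"
  using assms
proof induction
  case (forest V E ends)
  then have wf: "wf_graph V E ends" "loopless E ends" by (auto simp: is_forest_def)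
  have "transZ V E ends q t = q ^ card V / q ^ card E" for t
    using wf forest_bridge[OF forest] q0 by (intro transZ_all_bridges) (auto simp: wf_graph_def)
  then show ?case using wf q0 by simp
next
  case (series V E ends e a b w e1 e2)
  define E0 where "E0 = E - {e}"
  have E: "E = insert e E0" "e \<notin> E0" using series.hyps(2) by (auto simp: E0_def)
  have wf: "wf_graph V E ends" "loopless E ends" using series.IH by auto
  have fin: "finite V" "finite E0" using wf by (auto simp: wf_graph_def E0_def)
  have "ends e \<subseteq> V" "card (ends e) = 2" using wf series.hyps(2) by (auto simp: wf_graph_def loopless_def)
  then have ab: "a \<in> V" "b \<in> V" "a \<noteq> b" using series.hyps(3) by auto
  have E0V: "ends f \<subseteq> V" if "f \<in> E0" for f using wf that by (auto simp: wf_graph_def E0_def)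
  have w: "w \<noteq> a" "w \<noteq> b" using ab series.hyps(4) by auto
  interpret S: series_extension E0 ends e e1 e2 a b w
    using fin E(2) series.hyps w by unfold_locales (auto simp: E0_def)
  have eq: "insert e1 (insert e2 (E - {e})) = S.E'" "ends(e1 := {a, w}, e2 := {w, b}) = S.ends'"
    unfolding S.E'_def S.ends'_def by (simp_all add: E0_def)
  have ends': "S.ends' e1 = {a, w}" "S.ends' e2 = {w, b}" "\<And>f. f \<in> E0 \<Longrightarrow> S.ends' f = ends f"
    using S.new by (auto simp: S.ends'_def)
  have wf': "wf_graph (insert w V) S.E' S.ends'" "loopless S.E' S.ends'"
    using wf fin ab w E unfolding wf_graph_def loopless_def S.E'_def
    by (auto simp: ends' card_insert_if)
  have "transZ (insert w V) S.E' S.ends' q t \<noteq> 0"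
    if c: "\<forall>e\<in>S.E'. 1 \<le> c e" and cb: "cut_bounded (insert w V) S.E' S.ends' c (Suc n)"
      and t: "\<forall>e\<in>S.E'. bridge S.E' S.ends' e \<or> admissible (c e) (t e)" for c t
  proof -
    let ?c = "c(e := min (c e1) (c e2))" and ?t = "t(e := t e1 * t e2)"
    have mem: "e1 \<in> S.E'" "e2 \<in> S.E'" "\<And>f. f \<in> E0 \<Longrightarrow> f \<in> S.E'" by (auto simp: S.E'_def)
    have c': "\<forall>f\<in>E. 1 \<le> ?c f" using c mem by (auto simp: E(1))
    have cb': "cut_bounded V E ends ?c (Suc n)"
      unfolding E(1) by (rule cut_bounded_transfer[OF cb _ S.sum_cut_le]) auto
    have "bridge E ends f \<or> admissible (?c f) (?t f)" if "f \<in> E" for f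
    proof (cases "f = e")
      case False
      then have "f \<in> E0" using that E by simp
      then show ?thesis using t mem(3) S.bridge_old[of f] False by (auto simp: E(1))
    next
      case True
      show ?thesis
      \<comment> \<open>If \<open>e\<close> is a bridge nothing has to be known about its weight.
        Otherwise neither \<open>e1\<close> nor \<open>e2\<close> is a bridge, so both weights are
        admissible.\<close>
      proof (cases "bridge E ends e")
        case nb: False
        then have "\<not> bridge S.E' S.ends' e1" "\<not> bridge S.E' S.ends' e2"
          using S.bridge_new by (auto simp: E(1))
        then have "admissible (c e1) (t e1)" "admissible (c e2) (t e2)" using t mem by auto
        moreover have "?c e \<le> n"
          by (rule nonbridge_capacity[of E V ends ?c n e a b, OF _ cb'])
            (use c' nb ab series.hyps fin E in auto)
        ultimately have "admissible (min (c e1) (c e2)) (t e1 * t e2)"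
          using c mem by (intro admissible_series) auto
        then show ?thesis using True by simp
      qed (use True in simp)
    qed
    then have "transZ V E ends q ?t \<noteq> 0" using series.IH c' cb' by blast
    moreover have "transZ (insert w V) S.E' S.ends' q t = transZ V (insert e E0) ends q ?t"
      unfolding S.E'_def S.ends'_def
      by (rule transZ_series) (use fin E series.hyps ab S.new E0V q0 in auto)
    ultimately show ?thesis by (simp add: E(1))
  qed
  then show ?case unfolding eq using wf' by blast
next
  case (parallel V E ends e e1 e2)
  define E0 where "E0 = E - {e}"
  have E: "E = insert e E0" "e \<notin> E0" using parallel.hyps(2) by (auto simp: E0_def)
  have wf: "wf_graph V E ends" "loopless E ends" using parallel.IH by auto
  have fin: "finite V" "finite E0" using wf by (auto simp: wf_graph_def E0_def)
  have eV: "ends e \<subseteq> V" "card (ends e) = 2"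
    using wf parallel.hyps(2) by (auto simp: wf_graph_def loopless_def)
  then obtain a b where ab: "ends e = {a, b}" "a \<noteq> b" "a \<in> V" "b \<in> V" by (auto simp: card_2_iff)
  interpret S: parallel_extension E0 ends e e1 e2
    using fin E(2) parallel.hyps by unfold_locales (auto simp: E0_def)
  have eq: "insert e1 (insert e2 (E - {e})) = S.E'" "ends(e1 := ends e, e2 := ends e) = S.ends'"
    unfolding S.E'_def S.ends'_def by (simp_all add: E0_def)
  have ends': "S.ends' e1 = ends e" "S.ends' e2 = ends e" "\<And>f. f \<in> E0 \<Longrightarrow> S.ends' f = ends f"
    using S.new by (auto simp: S.ends'_def)
  have wf': "wf_graph V S.E' S.ends'" "loopless S.E' S.ends'"
    using wf fin eV E unfolding wf_graph_def loopless_def S.E'_def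
    by (auto simp: ends')
  have "transZ V S.E' S.ends' q t \<noteq> 0"
    if c: "\<forall>e\<in>S.E'. 1 \<le> c e" and cb: "cut_bounded V S.E' S.ends' c (Suc n)"
      and t: "\<forall>e\<in>S.E'. bridge S.E' S.ends' e \<or> admissible (c e) (t e)" for c t
  proof -
    let ?c = "c(e := c e1 + c e2)"
    let ?t = "t(e := (t e1 + t e2 + (q - 2) * (t e1 * t e2)) / (1 + (q - 1) * (t e1 * t e2)))"
    have mem: "e1 \<in> S.E'" "e2 \<in> S.E'" "\<And>f. f \<in> E0 \<Longrightarrow> f \<in> S.E'" by (auto simp: S.E'_def)
    have c12: "1 \<le> c e1" "1 \<le> c e2" using c mem by auto
    have c': "\<forall>f\<in>E. 1 \<le> ?c f" using c mem c12 by (auto simp: E(1))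
    have cb': "cut_bounded V E ends ?c (Suc n)"
      unfolding E(1) by (rule cut_bounded_transfer[OF cb _ S.sum_cut_le]) auto
    have adm: "admissible (c e1) (t e1)" "admissible (c e2) (t e2)"
      using t mem S.bridge_new by auto
    have "bridge E ends f \<or> admissible (?c f) (?t f)" if "f \<in> E" for f
    proof (cases "f = e")
      case False
      then have "f \<in> E0" using that E by simp
      then show ?thesis using t mem(3) S.bridge_old[of f] False by (auto simp: E(1))
    next
      case True
      show ?thesis
      \<comment> \<open>Here the sum of the capacities may reach \<open>Suc n\<close>, where no
        radius is available; only a non-bridge is guaranteed to stay within
        \<open>n\<close>.\<close>
      proof (cases "bridge E ends e")
        case nb: False
        have "?c e \<le> n"
          by (rule nonbridge_capacity[of E V ends ?c n e a b, OF _ cb'])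
            (use c' nb ab parallel.hyps fin E in auto)
        then have "admissible (c e1 + c e2)
          ((t e1 + t e2 + (q - 2) * (t e1 * t e2)) / (1 + (q - 1) * (t e1 * t e2)))"
          using adm c12 by (intro admissible_parallel) auto
        then show ?thesis using True by simp
      qed (use True in simp)
    qed
    then have nz0: "transZ V E ends q ?t \<noteq> 0" using parallel.IH c' cb' by blast
    have nz: "1 + (q - 1) * (t e1 * t e2) \<noteq> 0" using parallel_nonzero[OF adm c12] .
    have "transZ V S.E' S.ends' q t =
      (1 + (q - 1) * (t e1 * t e2)) / q * transZ V (insert e E0) ends q ?t"
      unfolding S.E'_def S.ends'_def
      by (rule transZ_parallel) (use fin E S.new q0 nz in auto)
    then show ?thesis using nz0 nz q0 by (simp add: E(1))
  qed
  then show ?case unfolding eq using wf' by blast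
qed

end

section \<open>From maxmaxflow and edge weights to the zero-free region\<close>

lemma tutteZ_cong:
  assumes "\<And>e. e \<in> E \<Longrightarrow> ends e = ends' e"
  shows "tutteZ V E ends q v = tutteZ V E ends' q v"
  unfolding tutteZ_def using assms
  by (intro sum.cong refl arg_cong2[of _ _ _ _ "(*)"] arg_cong2[of _ _ _ _ "(^)"] num_components_cong) auto

lemma tutteZ_nonzero:
  fixes q :: complex and v :: "'e \<Rightarrow> complex"
  assumes "L \<ge> 2" "wf_graph V E ends" "loopless E ends" "series_parallel V E ends"
    and "maxmaxflow V E ends \<le> L"
    and \<rho>: "\<rho> = 1 / cmod (q - 1)" "0 < \<rho>" "\<rho> < 1" "(1 + \<rho>) ^ L \<le> 2 * (1 + \<rho>\<^sup>2) ^ (L - 1)"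
    and X: "X = (2 / (1 + \<rho>)) powr (1 / (real L - 1))"
    and v: "\<And>e. e \<in> E \<Longrightarrow> v e = -1 \<or>
      q + v e \<noteq> 0 \<and> cmod (v e / (q + v e)) \<le> \<rho> * (X - 1) / (1 - \<rho> * X)"
  shows "tutteZ V E ends q v \<noteq> 0"
proof -
  define n where "n = L - 1"
  have n: "L = Suc n" "n \<ge> 1" "real L - 1 = real n" using assms(1) by (auto simp: n_def)
  have X1: "1 \<le> X"
    unfolding X n(3) using \<rho>(2,3) n(2) by (intro ge_one_powr_ge_zero) (auto simp: pos_le_divide_eq)
  have Xn: "X ^ n = 2 / (1 + \<rho>)"
  proof -
    have "X ^ n = X powr real n" using X1 by (simp add: powr_realpow)
    also have "\<dots> = 2 / (1 + \<rho>)" unfolding X n(3) using \<rho> n(2) by (simp add: powr_powr)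
    finally show ?thesis .
  qed
  \<comment> \<open>The largest exponent gives \<open>2 * \<rho> / (1 + \<rho>) < 1\<close>, so the
    denominators of the radii stay positive throughout the range of the induction.\<close>
  have lt1: "\<rho> * X ^ k < 1" if "k \<le> n" for k
  proof -
    have "X ^ k \<le> X ^ n" using that X1 by (intro power_increasing)
    then have "\<rho> * X ^ k \<le> \<rho> * (2 / (1 + \<rho>))"
      unfolding Xn using \<rho>(2) by (intro mult_left_mono) auto
    also have "\<dots> < 1" using \<rho>(2,3) by (simp add: pos_divide_less_eq)
    finally show ?thesis .
  qed
  have Q: "cmod (q - 1) = 1 / \<rho>" unfolding \<rho>(1) by simp
  interpret flow_radii q n "flow_radius \<rho> X"
  proof
    show "cmod (q - 1) > 1" unfolding Q using \<rho>(2,3) by simp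
    show "1 \<le> n" by (rule n(2))
    show "flow_radius \<rho> X k \<le> flow_radius \<rho> X l" if "k \<le> l" "l \<le> n" for k l
      using flow_radius_le[OF \<rho>(2,3) X1 that(1)] lt1 that by simp
    show "(1 / cmod (q - 1))\<^sup>2 \<le> flow_radius \<rho> X 1"
      using flow_radius_one[OF \<rho>(2,3) X1 Xn] \<rho>(4) n lt1[of 1] unfolding \<rho>(1)[symmetric] by simp
    show "flow_radius \<rho> X n \<le> 1 / cmod (q - 1)"
      using flow_radius_top[OF \<rho>(2,3) Xn] unfolding \<rho>(1)[symmetric] by simp
    show "flow_radius \<rho> X k + flow_radius \<rho> X l + (cmod (q - 1) + 1) * flow_radius \<rho> X k * flow_radius \<rho> X l
      \<le> flow_radius \<rho> X (k + l) * (1 - cmod (q - 1) * flow_radius \<rho> X k * flow_radius \<rho> X l)"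
      if "k + l \<le> n" for k l
      unfolding Q using flow_radius_add[OF \<rho>(2,3) lt1 lt1 lt1, of k l] that by simp
  qed
  obtain ends' where ends': "\<And>e. e \<in> E \<Longrightarrow> ends' e = ends e" "sp_ind V E ends'"
    using assms(4) unfolding series_parallel_def by blast
  \<comment> \<open>With unit capacities the capacity of a cut is its number of edges, which
    Menger's theorem bounds.\<close>
  have "cut_bounded V E ends' (\<lambda>_. 1) (Suc n)"
    unfolding cut_bounded_def
  proof (intro ballI impI)
    fix x y assume "x \<in> V" "y \<in> V" "x \<noteq> y"
    then obtain S where "x \<in> S" "y \<notin> S" "card (cut E ends S) \<le> L"
      using maxmaxflow_cut[OF assms(2,3,5)] by metis
    moreover have "cut E ends' S = cut E ends S" using ends' by (intro cut_cong) auto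
    ultimately show "\<exists>S. x \<in> S \<and> y \<notin> S \<and> sum (\<lambda>_. 1) (cut E ends' S) \<le> Suc n"
      using n(1) by (intro exI[of _ S]) simp
  qed
  \<comment> \<open>At capacity 1 the radius is the bound assumed on the weights, and
    \<open>v = -1\<close> gives \<open>-1 / (q - 1)\<close>.\<close>
  moreover have "admissible 1 (v e / (q + v e))" if "e \<in> E" for e
    using v[OF that] n(2) by (auto simp: admissible_def flow_radius_def)
  ultimately have nz: "transZ V E ends' q (\<lambda>e. v e / (q + v e)) \<noteq> 0"
    using transZ_nonzero[OF ends'(2)] by auto
  have qv: "q + v e \<noteq> 0" if "e \<in> E" for e using v[OF that] q1 by auto
  have fin: "finite E" using assms(2) by (simp add: wf_graph_def)
  have "tutteZ V E ends q v = tutteZ V E ends' q v" using ends' by (intro tutteZ_cong) auto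
  also have "\<dots> = (\<Prod>e\<in>E. q + v e) * transZ V E ends' q (\<lambda>e. v e / (q + v e))"
    using fin q0 qv by (intro tutteZ_eq_transZ) auto
  also have "\<dots> \<noteq> 0" using nz qv fin by simp
  finally show ?thesis .
qed

theorem theorem5p1:
  fixes L :: nat and V :: "'v set" and E :: "'e set" and ends :: "'e \<Rightarrow> 'v set"
  assumes "L \<ge> 2"
    and "wf_graph V E ends" and "loopless E ends" and "series_parallel V E ends"
    and "maxmaxflow V E ends \<le> L"
  shows "(\<forall>(q::complex) (v::'e \<Rightarrow> complex).
            (if L = 2 then cmod (q - 1) > 1 / rho_star L else cmod (q - 1) \<ge> 1 / rho_star L) \<longrightarrow>
            (let \<rho> = 1 / cmod (q - 1); X = (2 / (1 + \<rho>)) powr (1 / (real L - 1)) in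
               (\<forall>e\<in>E. v e = -1 \<or>
                  (q + v e \<noteq> 0 \<and>
                   (if L = 2 then cmod (v e / (q + v e)) < \<rho> * (X - 1) / (1 - \<rho> * X)
                    else cmod (v e / (q + v e)) \<le> \<rho> * (X - 1) / (1 - \<rho> * X)))))
            \<longrightarrow> tutteZ V E ends q v \<noteq> 0)
       \<and> rho_star L > ln 2 / (real L - 3 / 2 * ln 2)
       \<and> (\<forall>q::complex. chrom_poly V E ends q = 0 \<longrightarrow>
            cmod (q - 1) < (real L - 3 / 2 * ln 2) / ln 2)"
proof -
  have star: "rho_star L > 0"
    using assms(1) rho_star_props(1)[of L] by (cases "L = 2") (auto simp: rho_star_def)
  have main: "tutteZ V E ends q v \<noteq> 0"
    if q: "if L = 2 then cmod (q - 1) > 1 / rho_star L else cmod (q - 1) \<ge> 1 / rho_star L"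
      and \<rho>: "\<rho> = 1 / cmod (q - 1)" and X: "X = (2 / (1 + \<rho>)) powr (1 / (real L - 1))"
      and v: "\<And>e. e \<in> E \<Longrightarrow> v e = -1 \<or>
        q + v e \<noteq> 0 \<and> cmod (v e / (q + v e)) \<le> \<rho> * (X - 1) / (1 - \<rho> * X)"
    for q :: complex and v :: "'e \<Rightarrow> complex" and \<rho> X :: real
  proof -
    have le: "cmod (q - 1) \<ge> 1 / rho_star L" using q by (auto split: if_splits)
    have "1 / rho_star L > 0" using star by simp
    then have pos: "cmod (q - 1) > 0" using le by linarith
    have r0: "\<rho> > 0" using \<rho> pos by simp
    have r1: "\<rho> \<le> rho_star L" using le star pos unfolding \<rho> by (simp add: field_simps)
    have r2: "L = 2 \<longrightarrow> \<rho> < rho_star L"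
    proof
      assume "L = 2"
      then have "cmod (q - 1) > 1 / rho_star L" using q by simp
      then show "\<rho> < rho_star L" using star pos unfolding \<rho> by (simp add: field_simps)
    qed
    note r = rho_le_rho_star[OF assms(1) r0 r1 r2]
    show ?thesis by (rule tutteZ_nonzero[OF assms \<rho> r0 r X v])
  qed
  have lower: "rho_star L > ln 2 / (real L - 3 / 2 * ln 2)"
    using assms(1) by (rule rho_star_lower_bound)
  have "cmod (q - 1) < (real L - 3 / 2 * ln 2) / ln 2" if "chrom_poly V E ends q = 0" for q
  proof (rule ccontr)
    assume *: "\<not> cmod (q - 1) < (real L - 3 / 2 * ln 2) / ln 2"
    have "ln 2 \<le> (25/36 :: real)" by (rule ln2_le_25_over_36)
    then have "real L - 3 / 2 * ln 2 > 0" using assms(1) by simp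
    then have "1 / rho_star L < (real L - 3 / 2 * ln 2) / ln 2"
      using lower star by (simp add: field_simps)
    \<comment> \<open>The strict lower bound on \<open>rho_star L\<close> gives a strict inequality
      here, which satisfies the condition on \<open>q\<close> for \<open>L = 2\<close> and for
      \<open>L > 2\<close> alike.\<close>
    then have "cmod (q - 1) > 1 / rho_star L" using * by linarith
    then have "tutteZ V E ends q (\<lambda>_. -1) \<noteq> 0" by (intro main[OF _ refl refl]) auto
    then show False using that by (simp add: chrom_poly_def)
  qed
  moreover have "(let \<rho> = 1 / cmod (q - 1); X = (2 / (1 + \<rho>)) powr (1 / (real L - 1)) in
               (\<forall>e\<in>E. v e = -1 \<or>
                  (q + v e \<noteq> 0 \<and>
                   (if L = 2 then cmod (v e / (q + v e)) < \<rho> * (X - 1) / (1 - \<rho> * X)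
                    else cmod (v e / (q + v e)) \<le> \<rho> * (X - 1) / (1 - \<rho> * X)))))
            \<longrightarrow> tutteZ V E ends q v \<noteq> 0"
    if "if L = 2 then cmod (q - 1) > 1 / rho_star L else cmod (q - 1) \<ge> 1 / rho_star L"
    for q :: complex and v :: "'e \<Rightarrow> complex"
    unfolding Let_def
    by (intro impI main[OF that refl refl]) (auto split: if_splits)
  ultimately show ?thesis using lower by blast
qed

end
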